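(* Suppose that there is $\sigma\in\mathbb{R}_+$ such that $\alpha_j(t)=\alpha_j^*+o(e^{-\sigma t})$ as $t\to\infty$ for all $j\in\{0,1,\dots,n\}$, where the $\alpha_j(t)$ are the coefficients of the differential equation $\sum_{i=0}^n \alpha_{n-i}(t)D^ix(t)=0$ and the $\alpha_j^*$ are constants. Let $x:\mathbb{R}_{0+}\to\mathbb{R}$ be a solution of this equation that does not vanish for all large $t$. Consider any finite constant sampling period $T\in\mathbb{R}_+$. Then there are some $\mu_T\in\mathbb{R}_+$ with $\Lambda(\mu_T):=\{z\in\mathbb{C}:\Delta_T(z)=0,\ |z|=\mu_T\}\ne\varnothing$ and some $\varepsilon_T\in(0,\mu_T)$ such that $$x(kT+\tau)=x^*(kT+\tau)+O\big((\mu_T-\varepsilon_T)^k\big),\quad \forall\tau\in[0,T),\quad\text{as } t=kT+\tau\to\infty,\ k\in\mathbb{N}_0,\ k\to\infty,$$ where $x^*(t)$ is a nontrivial characteristic solution, corresponding to the set $\Lambda(\mu_T)$, of the limiting differential equation $\sum_{i=0}^n\alpha_{n-i}^*D^ix(t)=0$.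
   Context: $\mathbb{R}_{0+}=[0,\infty)$, $\mathbb{R}_+=(0,\infty)$, $\mathbb{N}_0=\{0,1,2,\dots\}$, $D=d/dt$. The differential equation is $\sum_{i=0}^n \alpha_{n-i}(t)D^ix(t)=0$ on $\mathbb{R}_{0+}$ with arbitrary initial conditions $D^ix(0)$, $0\le i\le n-1$, where $\alpha_i:\mathbb{R}_{0+}\to\mathbb{C}$ are bounded piecewise continuous functions and $\alpha_0\equiv1$. The matrix $A^*$ is the $n\times n$ companion matrix whose first $n-1$ rows are $[\,0\ \vdots\ I_{n-1}]$ and whose last row is $(-\alpha_n^*,-\alpha_{n-1}^*,\dots,-\alpha_1^* )$. For $T\in\mathbb{R}_+$, $\Delta_T(z)$ denotes the characteristic polynomial of the matrix $e^{A^*T}$. The limiting difference equation for the sampling period $T$ is the $n$th-order scalar linear difference equation with constant coefficients satisfied by the samples $x^*_k=x^*(kT)$ of solutions of the limiting differential equation; it is obtained from the system $z^*_{k+1}=e^{A^*T}z^*_k$, $x_k^*=e_1^Tz_k^*$ with $e_1=(1,0,\dots,0)^T$, and its characteristic polynomial is $\Delta_T$. A characteristic solution of the limiting difference equation corresponding to a root $\lambda$ of $\Delta_T$ of multiplicity $m_\lambda$ is one of the form $p(k)\lambda^k$ with $p$ a polynomial of degree less than $m_\lambda$. A characteristic solution corresponding to a set $\Lambda$ of roots is a finite sum of characteristic solutions corresponding to elements of $\Lambda$. A characteristic solution of the limiting differential equation corresponding to $\Lambda(\mu_T)$ is a solution $x^*(t)$ whose samples $x^*(kT)$ form such a characteristic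 solution of the limiting difference equation. "Nontrivial" means not identically zero. $o$ and $O$ are the standard Landau symbols. *)

theory Defs
  imports
    "HOL-Analysis.Analysis"
    "HOL-Library.Landau_Symbols"
    "Jordan_Normal_Form.Char_Poly"
begin

text \<open>Functions on \<open>[0,\<infinity>)\<close> are total functions on \<^typ>\<open>real\<close> of which only the values on
  \<open>{0..}\<close> matter; limits and derivatives at \<open>0\<close> are one-sided.\<close>

definition piecewise_continuous :: "(real \<Rightarrow> complex) \<Rightarrow> bool" where
  "piecewise_continuous f \<longleftrightarrow>
     (\<forall>b. finite {t \<in> {0..b}. \<not> continuous (at t within {0..}) f}) \<and>
     (\<forall>t\<ge>0. \<exists>l. (f \<longlongrightarrow> l) (at_right t)) \<and>
     (\<forall>t>0. \<exists>l. (f \<longlongrightarrow> l) (at_left t))"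

text \<open>\<open>x\<close> solves \<open>\<Sum>i\<le>n. \<alpha>\<^sub>n\<^sub>-\<^sub>i(t) D\<^sup>ix(t) = 0\<close> on \<open>[0,\<infinity>)\<close>, where \<open>d i\<close> stands for \<open>D\<^sup>ix\<close> and \<open>n \<ge> 1\<close>.
  As usual for piecewise continuous coefficients, \<open>x\<close> is \<open>n-1\<close> times continuously differentiable,
  and \<open>D\<^sup>nx\<close> need exist and the equation need hold only at the points where all coefficients are
  continuous. For constant coefficients this is a classical solution.\<close>

definition ode_solution :: "nat \<Rightarrow> (nat \<Rightarrow> real \<Rightarrow> complex) \<Rightarrow> (real \<Rightarrow> complex) \<Rightarrow> bool" where
  "ode_solution n \<alpha> x \<longleftrightarrow>
     (\<exists>d :: nat \<Rightarrow> real \<Rightarrow> complex.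
        (\<forall>t\<ge>0. d 0 t = x t) \<and>
        (\<forall>i. Suc i < n \<longrightarrow>
           (\<forall>t\<ge>0. (d i has_vector_derivative d (Suc i) t) (at t within {0..}))) \<and>
        continuous_on {0..} (d (n - 1)) \<and>
        (\<forall>t\<ge>0. (\<forall>j\<le>n. continuous (at t within {0..}) (\<alpha> j)) \<longrightarrow>
           (d (n - 1) has_vector_derivative d n t) (at t within {0..}) \<and>
           (\<Sum>i\<le>n. \<alpha> (n - i) t * d i t) = 0))"

text \<open>The last row is \<open>(-a\<^sub>n, -a\<^sub>n\<^sub>-\<^sub>1, \<dots>, -a\<^sub>1)\<close>; indices start from \<open>0\<close>.\<close>

definition companion_matrix :: "nat \<Rightarrow> (nat \<Rightarrow> complex) \<Rightarrow> complex mat" where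
  "companion_matrix n a = mat n n (\<lambda>(i, j).
     if Suc i < n then (if j = Suc i then 1 else 0) else - a (n - j))"

definition mat_exp :: "complex mat \<Rightarrow> complex mat" where
  "mat_exp A = mat (dim_row A) (dim_row A) (\<lambda>(i, j). \<Sum>k. (A ^\<^sub>m k) $$ (i, j) / fact k)"

definition sampled_char_poly :: "nat \<Rightarrow> (nat \<Rightarrow> complex) \<Rightarrow> real \<Rightarrow> complex poly" where
  "sampled_char_poly n a T = char_poly (mat_exp (complex_of_real T \<cdot>\<^sub>m companion_matrix n a))"

text \<open>The linear difference equation with characteristic polynomial \<open>P\<close>.\<close>

definition difference_solution :: "complex poly \<Rightarrow> (nat \<Rightarrow> complex) \<Rightarrow> bool" where
  "difference_solution P y \<longleftrightarrow> (\<forall>k. (\<Sum>i\<le>degree P. coeff P i * y (k + i)) = 0)"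

definition char_solution :: "complex poly \<Rightarrow> complex \<Rightarrow> (nat \<Rightarrow> complex) \<Rightarrow> bool" where
  "char_solution P z y \<longleftrightarrow>
     poly P z = 0 \<and> difference_solution P y \<and>
     (\<exists>p. degree p < Polynomial.order z P \<and> (\<forall>k. y k = poly p (of_nat k) * z ^ k))"

text \<open>One summand per root is enough, since the characteristic solutions for one root are closed
  under addition.\<close>

definition char_solution_set :: "complex poly \<Rightarrow> complex set \<Rightarrow> (nat \<Rightarrow> complex) \<Rightarrow> bool" where
  "char_solution_set P \<Lambda> y \<longleftrightarrow>
     (\<exists>F w. finite F \<and> F \<subseteq> \<Lambda> \<and> (\<forall>z\<in>F. char_solution P z (w z)) \<and>
            (\<forall>k. y k = (\<Sum>z\<in>F. w z k)))"

definition root_circle :: "nat \<Rightarrow> (nat \<Rightarrow> complex) \<Rightarrow> real \<Rightarrow> real \<Rightarrow> complex set" where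
  "root_circle n a T \<mu> = {z. poly (sampled_char_poly n a T) z = 0 \<and> cmod z = \<mu>}"

definition ode_char_solution ::
    "nat \<Rightarrow> (nat \<Rightarrow> complex) \<Rightarrow> real \<Rightarrow> complex set \<Rightarrow> (real \<Rightarrow> complex) \<Rightarrow> bool" where
  "ode_char_solution n a T \<Lambda> x \<longleftrightarrow>
     ode_solution n (\<lambda>j _. a j) x \<and>
     char_solution_set (sampled_char_poly n a T) \<Lambda> (\<lambda>k. x (real k * T))"

end

theory Submission
  imports Defs "Jordan_Normal_Form.Schur_Decomposition"
begin

text \<open>Write the equation as the limiting one with the right-hand side \<open>f = \<Sum> (\<alpha>* - \<alpha>) D\<^sup>ix\<close>. If
  \<open>x, \<dots>, D\<^sup>n\<^sup>-\<^sup>1x\<close> are \<open>O(e\<^sup>c\<^sup>t)\<close>, then \<open>f = O(e\<^sup>(\<^sup>c\<^sup>-\<^sup>\<sigma>\<^sup>)\<^sup>t)\<close>, and factoring the limiting operator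
  into first-order factors gives an exact solution of the limiting equation that approximates \<open>x\<close> and
  its derivatives up to \<open>O(e\<^sup>b\<^sup>t)\<close>, for every \<open>b > c - \<sigma>\<close> that is not the real part of a
  characteristic root. Either the part of that solution growing faster than \<open>e\<^sup>b\<^sup>t\<close> vanishes and \<open>c\<close>
  may be replaced by \<open>b\<close>, or its fastest growing component is the required \<open>x*\<close>. The first
  alternative cannot recur forever, because the coefficients are bounded and hence a nonzero
  solution decays at most exponentially. Sampling is controlled by the triangular form of the companion
  matrix: the roots of \<open>\<Delta>\<^sub>T\<close> are the numbers \<open>e\<^sup>T\<^sup>\<nu>\<close>, with at least the multiplicity of \<open>\<nu>\<close>.\<close>

section \<open>Characteristic polynomials of companion matrices and matrix exponentials\<close>

text \<open>Laplace expansion along the first column leaves two cofactors. As the last row is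
  indexed from the right, deleting row and column 0 gives the companion matrix of order n for the
  same \<open>a\<close>. The other minor is lower triangular with diagonal entries -1, which cancel
  the sign of its cofactor.\<close>

lemma char_poly_companion_matrix:
  "char_poly (companion_matrix n a) = monom 1 n + (\<Sum>i<n. monom (a (n - i)) i)"
proof (induction n)
  case 0
  show ?case by (simp add: char_poly_def det_def char_poly_matrix_def companion_matrix_def)
next
  case (Suc n)
  define A where "A = char_poly_matrix (companion_matrix (Suc n) a)"
  have entry: "char_poly_matrix (companion_matrix m a) $$ (i, j) =
      (if i = j then [:0, 1:] else 0) +
      (if Suc i < m then (if j = Suc i then [:-1:] else 0) else [:a (m - j):])"
    if "i < m" "j < m" for i j m
    using that by (auto simp: char_poly_matrix_def companion_matrix_def)
  have carrier: "char_poly_matrix (companion_matrix m a) \<in> carrier_mat m m" for m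
    by (simp add: companion_matrix_def)
  have A: "A \<in> carrier_mat (Suc n) (Suc n)" unfolding A_def by (rule carrier)
  have first: "mat_delete A 0 0 = char_poly_matrix (companion_matrix n a)"
  proof (rule eq_matI)
    fix i j
    assume "i < dim_row (char_poly_matrix (companion_matrix n a))"
      and "j < dim_col (char_poly_matrix (companion_matrix n a))"
    hence ij: "i < n" "j < n" using carrier[of n] by auto
    have "mat_delete A 0 0 $$ (i, j) = A $$ (Suc i, Suc j)"
      using mat_delete_index[OF A, of 0 0 i j] ij by (simp add: insert_index_def)
    thus "mat_delete A 0 0 $$ (i, j) = char_poly_matrix (companion_matrix n a) $$ (i, j)"
      unfolding A_def using ij by (simp add: entry)
  qed (use A carrier[of n] in auto)
  define B where "B = mat_delete A n 0"
  have B: "B \<in> carrier_mat n n" unfolding B_def using mat_delete_carrier[OF A] by simp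
  have Bij: "B $$ (i, j) = (if i = Suc j then [:0, 1:] else 0) + (if j = i then [:-1:] else 0)"
    if ij: "i < n" "j < n" for i j
  proof -
    have "B $$ (i, j) = A $$ (i, Suc j)"
      unfolding B_def using mat_delete_index[OF A, of n 0 i j] ij by (simp add: insert_index_def)
    thus ?thesis unfolding A_def using ij by (simp add: entry)
  qed
  have "det B = prod_list (diag_mat B)"
    by (rule det_lower_triangular[OF _ B]) (auto simp: Bij)
  also have "diag_mat B = replicate n [:-1:]"
    using B by (intro nth_equalityI) (auto simp: diag_mat_def Bij)
  finally have detB: "det B = [:-1:] ^ n" by simp
  have sign: "(-1) ^ n * [:-1:] ^ n = (1 :: complex poly)"
  proof -
    have "(-1) ^ n * [:-1:] ^ n = ((-1) * [:-1:] :: complex poly) ^ n" by (rule power_mult_distrib[symmetric])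
    also have "(-1) * [:-1:] = (1 :: complex poly)" by (simp add: one_pCons)
    finally show ?thesis by simp
  qed
  \<comment> \<open>The two contributions are added rather than separated by cases, because for n =
    0 both fall on the same entry.\<close>
  have col: "A $$ (i, 0) = (if i = 0 then [:0, 1:] else 0) + (if i = n then [:a (Suc n):] else 0)"
    if "i < Suc n" for i
    unfolding A_def using that by (auto simp: entry)
  have "char_poly (companion_matrix (Suc n) a) = (\<Sum>i<Suc n. A $$ (i, 0) * cofactor A i 0)"
    unfolding char_poly_def A_def[symmetric] by (rule laplace_expansion_column[OF A]) simp
  also have "\<dots> = (\<Sum>i<Suc n. (if i = 0 then [:0, 1:] * cofactor A 0 0 else 0) +
      (if i = n then [:a (Suc n):] * cofactor A n 0 else 0))"
    by (rule sum.cong) (auto simp: col algebra_simps)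
  also have "\<dots> = [:0, 1:] * cofactor A 0 0 + [:a (Suc n):] * cofactor A n 0"
    by (simp only: sum.distrib sum.delta finite_lessThan) simp
  also have "cofactor A 0 0 = char_poly (companion_matrix n a)"
    by (simp add: cofactor_def first char_poly_def)
  also have "cofactor A n 0 = 1"
    using sign detB by (simp add: cofactor_def B_def)
  finally have "char_poly (companion_matrix (Suc n) a) =
      [:0, 1:] * (monom 1 n + (\<Sum>i<n. monom (a (n - i)) i)) + [:a (Suc n):]"
    by (simp add: Suc.IH)
  also have "\<dots> = monom 1 (Suc n) + (\<Sum>i<Suc n. monom (a (Suc n - i)) i)"
    by (simp add: sum.lessThan_Suc_shift distrib_left sum_distrib_left monom_Suc monom_0
        del: sum.lessThan_Suc)
  finally show ?case .
qed

section \<open>Exponentials of similar and of triangular matrices\<close>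

lemma mat_mult_entry:
  assumes "A \<in> carrier_mat n n" "B \<in> carrier_mat n n" "i < n" "j < n"
  shows "(A * B) $$ (i, j) = (\<Sum>l<n. A $$ (i, l) * B $$ (l, j))"
  using assms by (simp add: scalar_prod_def lessThan_atLeast0)

text \<open>Each further factor multiplies the bound by n * c, so the exponential series is
  dominated entrywise by the scalar series of exp (n * c).\<close>

lemma mat_pow_entry_bound:
  fixes A :: "complex mat"
  assumes A: "A \<in> carrier_mat n n" and c: "\<And>i j. i < n \<Longrightarrow> j < n \<Longrightarrow> cmod (A $$ (i, j)) \<le> c"
    and "i < n" "j < n"
  shows "cmod ((A ^\<^sub>m k) $$ (i, j)) \<le> (of_nat n * c) ^ k"
  using assms(3,4)
proof (induction k arbitrary: i j)
  case 0
  then show ?case using A by auto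
next
  case (Suc k)
  have "0 \<le> c" using c[OF Suc.prems] norm_ge_zero order_trans by blast
  have "cmod ((A ^\<^sub>m Suc k) $$ (i, j)) = cmod (\<Sum>l<n. (A ^\<^sub>m k) $$ (i, l) * A $$ (l, j))"
    using A Suc.prems by (simp only: pow_mat.simps) (subst mat_mult_entry[where n = n], auto)
  also have "\<dots> \<le> (\<Sum>l<n. (of_nat n * c) ^ k * c)"
    using Suc \<open>0 \<le> c\<close> by (intro sum_norm_le) (auto simp: norm_mult intro!: mult_mono c)
  finally show ?case by (simp add: mult_ac)
qed

lemma mat_exp_summable:
  fixes A :: "complex mat"
  assumes A: "A \<in> carrier_mat n n" and "i < n" "j < n"
  shows "summable (\<lambda>k. (A ^\<^sub>m k) $$ (i, j) / fact k)"
proof -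
  define c where "c = Max ((\<lambda>(i, j). cmod (A $$ (i, j))) ` ({..<n} \<times> {..<n}))"
  have c: "cmod (A $$ (i, j)) \<le> c" if "i < n" "j < n" for i j
    unfolding c_def using that by (intro Max_ge) auto
  show ?thesis
  proof (rule summable_comparison_test')
    show "summable (\<lambda>k. inverse (fact k) * (of_nat n * c) ^ k)" by (rule summable_exp)
    show "norm ((A ^\<^sub>m k) $$ (i, j) / fact k) \<le> inverse (fact k) * (of_nat n * c) ^ k" for k
      using mat_pow_entry_bound[OF A c assms(2,3), of k]
      by (simp add: norm_divide divide_simps)
  qed
qed

lemma mat_exp_carrier: "A \<in> carrier_mat n n \<Longrightarrow> mat_exp A \<in> carrier_mat n n"
  by (simp add: mat_exp_def)

lemma triple_mat_mult_entry:
  assumes "P \<in> carrier_mat n n" "B \<in> carrier_mat n n" "Q \<in> carrier_mat n n" "i < n" "j < n"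
  shows "(P * B * Q) $$ (i, j) = (\<Sum>m<n. \<Sum>l<n. P $$ (i, l) * B $$ (l, m) * Q $$ (m, j))"
proof -
  have "(P * B * Q) $$ (i, j) = (\<Sum>m<n. (P * B) $$ (i, m) * Q $$ (m, j))"
    using assms by (intro mat_mult_entry) auto
  also have "\<dots> = (\<Sum>m<n. \<Sum>l<n. P $$ (i, l) * B $$ (l, m) * Q $$ (m, j))"
    using mat_mult_entry[OF assms(1,2,4)] by (simp add: sum_distrib_right)
  finally show ?thesis .
qed

text \<open>Conjugation commutes with powers, and an entry of a conjugated power is a finite linear
  combination of entries of the power, so the series may be summed entry by entry.\<close>

lemma mat_exp_similar:
  assumes "similar_mat_wit A B P Q"
  shows "similar_mat_wit (mat_exp A) (mat_exp B) P Q"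
proof -
  define n where "n = dim_row A"
  note w = similar_mat_witD[OF n_def assms]
  have "mat_exp A = P * mat_exp B * Q"
  proof (rule eq_matI)
    fix i j assume "i < dim_row (P * mat_exp B * Q)" "j < dim_col (P * mat_exp B * Q)"
    hence ij: "i < n" "j < n" using w by auto
    have "(\<lambda>k. \<Sum>m<n. \<Sum>l<n. P $$ (i, l) * ((B ^\<^sub>m k) $$ (l, m) / fact k) * Q $$ (m, j)) sums
        (\<Sum>m<n. \<Sum>l<n. P $$ (i, l) * (\<Sum>k. (B ^\<^sub>m k) $$ (l, m) / fact k) * Q $$ (m, j))"
      by (intro sums_sum sums_mult sums_mult2 summable_sums mat_exp_summable[OF w(5)]) auto
    moreover have "(\<Sum>m<n. \<Sum>l<n. P $$ (i, l) * ((B ^\<^sub>m k) $$ (l, m) / fact k) * Q $$ (m, j)) =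
        (A ^\<^sub>m k) $$ (i, j) / fact k" for k
      unfolding similar_mat_wit_pow_id[OF assms]
      using triple_mat_mult_entry[OF w(6) pow_carrier_mat[OF w(5)] w(7) ij, of k]
      by (simp add: sum_divide_distrib)
    ultimately have "(\<Sum>k. (A ^\<^sub>m k) $$ (i, j) / fact k) =
        (\<Sum>m<n. \<Sum>l<n. P $$ (i, l) * (\<Sum>k. (B ^\<^sub>m k) $$ (l, m) / fact k) * Q $$ (m, j))"
      by (simp add: sums_iff)
    also have "\<dots> = (\<Sum>m<n. \<Sum>l<n. P $$ (i, l) * mat_exp B $$ (l, m) * Q $$ (m, j))"
      using w(5) by (intro sum.cong refl) (simp add: mat_exp_def)
    also have "\<dots> = (P * mat_exp B * Q) $$ (i, j)"
      using triple_mat_mult_entry[OF w(6) mat_exp_carrier[OF w(5)] w(7) ij] by simp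
    finally show "mat_exp A $$ (i, j) = (P * mat_exp B * Q) $$ (i, j)"
      using w(4) ij by (simp add: mat_exp_def)
  qed (use w in \<open>auto simp: mat_exp_def\<close>)
  thus ?thesis
    using w mat_exp_carrier[OF w(4)] mat_exp_carrier[OF w(5)]
    unfolding similar_mat_wit_def Let_def by auto
qed

text \<open>In the sum for one more factor, the terms l < i vanish through the left factor and the
  terms l > i through the right one. Entries above the diagonal do not affect the characteristic
  polynomial.\<close>

lemma upper_triangular_pow:
  fixes B :: "complex mat"
  assumes B: "B \<in> carrier_mat n n" "upper_triangular B" and "j \<le> i" "i < n"
  shows "(B ^\<^sub>m k) $$ (i, j) = (if i = j then (B $$ (i, i)) ^ k else 0)"
  using assms(3,4)
proof (induction k arbitrary: i j)
  case 0
  then show ?case using B by auto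
next
  case (Suc k)
  have "(B ^\<^sub>m Suc k) $$ (i, j) = (\<Sum>l<n. (B ^\<^sub>m k) $$ (i, l) * B $$ (l, j))"
    using B Suc.prems by (simp only: pow_mat.simps) (subst mat_mult_entry[where n = n], auto)
  also have "\<dots> = (\<Sum>l<n. if l = i then (if i = j then (B $$ (i, i)) ^ Suc k else 0) else 0)"
  proof (rule sum.cong[OF refl])
    fix l assume "l \<in> {..<n}"
    hence l: "l < n" by simp
    consider "l < i" | "l = i" | "i < l" by linarith
    thus "(B ^\<^sub>m k) $$ (i, l) * B $$ (l, j) =
        (if l = i then (if i = j then (B $$ (i, i)) ^ Suc k else 0) else 0)"
    proof cases
      case 1
      thus ?thesis using Suc.IH[of l i] Suc.prems by simp
    next
      case 2
      thus ?thesis using Suc.IH[of i i] Suc.prems B by (auto simp: upper_triangular_def)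
    next
      case 3
      thus ?thesis using Suc.prems B l by (auto simp: upper_triangular_def)
    qed
  qed
  finally show ?case using Suc.prems by simp
qed

lemma mat_exp_upper_triangular:
  assumes B: "B \<in> carrier_mat n n" "upper_triangular B"
  shows "upper_triangular (mat_exp B)" "diag_mat (mat_exp B) = map exp (diag_mat B)"
proof -
  have e: "mat_exp B $$ (i, j) = (if i = j then exp (B $$ (i, i)) else 0)" if "j \<le> i" "i < n" for i j
  proof -
    have "mat_exp B $$ (i, j) = (\<Sum>k. (B ^\<^sub>m k) $$ (i, j) / fact k)"
      using B that by (simp add: mat_exp_def)
    also have "\<dots> = (\<Sum>k. if i = j then (B $$ (i, i)) ^ k / fact k else 0)"
      by (rule suminf_cong) (simp add: upper_triangular_pow[OF B that])
    also have "\<dots> = (if i = j then exp (B $$ (i, i)) else 0)"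
      by (simp add: exp_def scaleR_conv_of_real divide_inverse mult.commute)
    finally show ?thesis .
  qed
  show "upper_triangular (mat_exp B)"
    using mat_exp_carrier[OF B(1)] e by (auto simp: upper_triangular_def)
  show "diag_mat (mat_exp B) = map exp (diag_mat B)"
    using mat_exp_carrier[OF B(1)] B e by (intro nth_equalityI) (auto simp: diag_mat_def)
qed

text \<open>Schur triangularisation gives a triangular matrix with diagonal \<open>es\<close>;
  scaling and exponentiating it keep it triangular and act on the diagonal entrywise. With c = T
  this factors \<Delta>_T over the characteristic roots, with multiplicity.\<close>

lemma char_poly_mat_exp_smult:
  assumes A: "A \<in> carrier_mat n n" and es: "char_poly A = (\<Prod>a\<leftarrow>es. [:- a, 1:])"
  shows "char_poly (mat_exp (c \<cdot>\<^sub>m A)) = (\<Prod>a\<leftarrow>es. [:- exp (c * a), 1:])"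
proof -
  obtain B P Q where "schur_decomposition A es = (B, P, Q)" by (metis prod_cases3)
  from schur_decomposition[OF A es this]
  have wit: "similar_mat_wit A B P Q" and B: "upper_triangular B" "diag_mat B = es" by auto
  have carrier: "B \<in> carrier_mat n n" using similar_mat_witD2[OF A wit] by simp
  define C where "C = c \<cdot>\<^sub>m B"
  have C: "C \<in> carrier_mat n n" "upper_triangular C"
    using carrier B by (auto simp: C_def upper_triangular_def)
  have diagC: "diag_mat C = map ((*) c) es"
    unfolding B(2)[symmetric] C_def using carrier
    by (intro nth_equalityI) (auto simp: diag_mat_def)
  have "similar_mat (mat_exp (c \<cdot>\<^sub>m A)) (mat_exp C)"
    using mat_exp_similar[OF similar_mat_wit_smult[OF wit, of c]]
    unfolding similar_mat_def C_def by blast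
  hence "char_poly (mat_exp (c \<cdot>\<^sub>m A)) = char_poly (mat_exp C)"
    by (rule char_poly_similar)
  also have "\<dots> = (\<Prod>a\<leftarrow>diag_mat (mat_exp C). [:- a, 1:])"
    by (rule char_poly_upper_triangular[OF mat_exp_carrier[OF C(1)] mat_exp_upper_triangular(1)[OF C]])
  also have "\<dots> = (\<Prod>a\<leftarrow>es. [:- exp (c * a), 1:])"
    unfolding mat_exp_upper_triangular(2)[OF C] diagC by (simp add: o_def)
  finally show ?thesis .
qed

lemma power_count_dvd_prod_list:
  assumes "\<And>b. b \<in> set bs \<Longrightarrow> b = a \<Longrightarrow> g b = (q :: complex poly)"
  shows "q ^ count_list bs a dvd (\<Prod>b\<leftarrow>bs. g b)"
  using assms by (induction bs) (auto intro: mult_dvd_mono dvd_mult)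

lemma prod_list_linear_nonzero: "(\<Prod>a\<leftarrow>es. [:- g a, 1:]) \<noteq> (0 :: complex poly)"
  by (auto simp: prod_list_zero_iff)

text \<open>Equality can fail: distinct elements of \<open>es\<close> may have the same exponential,
  and then their multiplicities add up. The inequality is what bounds the degrees of the polynomial
  coefficients after sampling.\<close>

lemma count_le_order_exp:
  fixes c \<nu> :: complex
  assumes "P = (\<Prod>a\<leftarrow>es. [:- exp (c * a), 1:])"
  shows "count_list es \<nu> \<le> Polynomial.order (exp (c * \<nu>)) P"
proof -
  have "[:- exp (c * \<nu>), 1:] ^ count_list es \<nu> dvd P"
    unfolding assms by (rule power_count_dvd_prod_list[where g = "\<lambda>a. [:- exp (c * a), 1:]"]) simp
  thus ?thesis
    using prod_list_linear_nonzero[of "\<lambda>a. exp (c * a)" es] unfolding order_divides assms by simp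
qed

section \<open>Characteristic solutions of difference equations\<close>

text \<open>With E the shift of the index, this is Q(E) applied to (E - a) y. It serves difference
  equations, where y lists consecutive samples, and differential equations, where \<open>y i\<close>
  is the i-th derivative at a fixed time and E acts as D.\<close>

lemma poly_operator_linear_factor:
  fixes y :: "nat \<Rightarrow> complex"
  assumes "degree Q \<le> N"
  shows "(\<Sum>i\<le>Suc N. coeff ([:- a, 1:] * Q) i * y i) =
    (\<Sum>i\<le>N. coeff Q i * (y (Suc i) - a * y i))"
proof -
  have "(\<Sum>i\<le>Suc N. coeff ([:- a, 1:] * Q) i * y i) =
      (\<Sum>i\<le>Suc N. coeff (pCons 0 Q) i * y i) - a * (\<Sum>i\<le>Suc N. coeff Q i * y i)"
  proof -
    have "coeff ([:- a, 1:] * Q) i * y i = coeff (pCons 0 Q) i * y i - a * (coeff Q i * y i)" for i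
      by (simp add: algebra_simps)
    thus ?thesis by (simp only: sum_subtractf sum_distrib_left)
  qed
  also have "(\<Sum>i\<le>Suc N. coeff (pCons 0 Q) i * y i) = (\<Sum>i\<le>N. coeff Q i * y (Suc i))"
    by (simp add: sum.atMost_Suc_shift del: sum.atMost_Suc)
  also have "(\<Sum>i\<le>Suc N. coeff Q i * y i) = (\<Sum>i\<le>N. coeff Q i * y i)"
    using assms by (simp add: coeff_eq_0)
  finally show ?thesis by (simp add: sum_distrib_left sum_subtractf[symmetric] algebra_simps)
qed

text \<open>The leading coefficients of p(X + 1) and p(X) cancel. The zero polynomial has degree 0,
  hence the separate alternative, the only possible one for m = 0.\<close>

lemma degree_shift_diff:
  fixes p :: "complex poly"
  assumes "degree p < Suc m"
  shows "p \<circ>\<^sub>p [:1, 1:] - p = 0 \<or> degree (p \<circ>\<^sub>p [:1, 1:] - p) < m"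
proof (cases "degree p = 0")
  case True
  then obtain c where "p = [:c:]" by (rule degree_eq_zeroE)
  thus ?thesis by simp
next
  case False
  let ?r = "p \<circ>\<^sub>p [:1, 1:] - p"
  have deg: "degree (p \<circ>\<^sub>p [:1, 1:]) = degree p" by (simp add: degree_pcompose)
  have "lead_coeff (p \<circ>\<^sub>p [:1, 1:]) = lead_coeff p" by (subst lead_coeff_comp) auto
  hence "coeff ?r (degree p) = 0" using deg by simp
  moreover have "degree ?r \<le> degree p" using deg degree_diff_le[of "p \<circ>\<^sub>p [:1, 1:]" "degree p" p] by simp
  ultimately have "degree ?r < degree p \<or> ?r = 0"
    by (metis le_neq_implies_less leading_coeff_0_iff)
  thus ?thesis using assms by auto
qed

text \<open>The operator E - z sends p(k) z^k to z (p(k + 1) - p(k)) z^k, so each factor removed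
  from P lowers the degree of the coefficient polynomial until it is 0.\<close>

lemma difference_operator_exp_poly:
  fixes P p :: "complex poly"
  assumes "[:- z, 1:] ^ m dvd P" "P \<noteq> 0" "p = 0 \<or> degree p < m"
  shows "(\<Sum>i\<le>degree P. coeff P i * (poly p (of_nat (k + i)) * z ^ (k + i))) = 0"
  using assms
proof (induction m arbitrary: P p)
  case 0
  thus ?case by simp
next
  case (Suc m)
  from Suc.prems(1) obtain Q where P: "P = [:- z, 1:] * ([:- z, 1:] ^ m * Q)"
    unfolding power_Suc mult.assoc dvd_def by blast
  define R where "R = [:- z, 1:] ^ m * Q"
  have "R \<noteq> 0" using Suc.prems(2) P R_def by auto
  have PR: "P = [:- z, 1:] * R" unfolding P R_def ..
  have degP: "degree P = Suc (degree R)" unfolding PR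
    using \<open>R \<noteq> 0\<close> by (subst degree_mult_eq) auto
  define r where "r = Polynomial.smult z (p \<circ>\<^sub>p [:1, 1:] - p)"
  have r: "r = 0 \<or> degree r < m"
    using degree_shift_diff[of p m] Suc.prems(3) unfolding r_def
    by (cases "p = 0") (auto simp: degree_smult_le le_less_trans[OF degree_smult_le])
  have "(\<Sum>i\<le>degree P. coeff P i * (poly p (of_nat (k + i)) * z ^ (k + i))) =
      (\<Sum>i\<le>degree R. coeff R i * (poly p (of_nat (k + Suc i)) * z ^ (k + Suc i) -
        z * (poly p (of_nat (k + i)) * z ^ (k + i))))"
    unfolding degP by (subst PR, rule poly_operator_linear_factor) simp
  also have "\<dots> = (\<Sum>i\<le>degree R. coeff R i * (poly r (of_nat (k + i)) * z ^ (k + i)))"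
    by (simp add: r_def poly_pcompose algebra_simps)
  also have "\<dots> = 0"
    by (rule Suc.IH[OF _ \<open>R \<noteq> 0\<close> r]) (simp add: R_def)
  finally show ?case .
qed

lemma char_solutionI:
  assumes "P \<noteq> 0" "degree p < Polynomial.order z P" "\<And>k. y k = poly p (of_nat k) * z ^ k"
  shows "char_solution P z y"
proof -
  have "poly P z = 0" using assms(1,2) by (metis gr_implies_not0 order_0I)
  moreover have "difference_solution P y"
    unfolding difference_solution_def assms(3)
    using difference_operator_exp_poly[OF order_1 assms(1), of p z] assms(2) by blast
  ultimately show ?thesis unfolding char_solution_def using assms(2,3) by blast
qed

section \<open>Exponential polynomials and exponential bounds\<close>

definition expoly :: "complex \<Rightarrow> complex poly \<Rightarrow> real \<Rightarrow> complex" where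
  "expoly \<nu> q t = poly q (of_real t) * exp (\<nu> * of_real t)"

definition expoly_deriv :: "complex \<Rightarrow> complex poly \<Rightarrow> complex poly" where
  "expoly_deriv \<nu> q = pderiv q + Polynomial.smult \<nu> q"

text \<open>Requiring the bound on all of [0, infinity), not only for large t, allows it to be
  integrated from 0 and sampled at every k.\<close>

definition exp_bounded :: "real \<Rightarrow> (real \<Rightarrow> complex) \<Rightarrow> bool" where
  "exp_bounded b f \<longleftrightarrow> (\<exists>K. \<forall>t\<ge>0. cmod (f t) \<le> K * exp (b * t))"

lemma has_vector_derivative_expoly:
  "(expoly \<nu> q has_vector_derivative expoly \<nu> (expoly_deriv \<nu> q) t) (at t within S)"
proof -
  have "((\<lambda>z. poly q z * exp (\<nu> * z)) has_field_derivative
      poly (pderiv q) (of_real t) * exp (\<nu> * of_real t) + exp (\<nu> * of_real t) * \<nu> * poly q (of_real t))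
      (at (of_real t))"
    by (auto intro!: derivative_eq_intros)
  from has_vector_derivative_real_field[OF this] show ?thesis
    unfolding expoly_def [abs_def] expoly_deriv_def
    by (simp add: algebra_simps has_vector_derivative_at_within)
qed

lemma expoly_simps:
  "expoly \<nu> (p + q) t = expoly \<nu> p t + expoly \<nu> q t"
  "expoly \<nu> (p - q) t = expoly \<nu> p t - expoly \<nu> q t"
  "expoly \<nu> (Polynomial.smult c p) t = c * expoly \<nu> p t"
  "expoly \<nu> 0 t = 0"
  by (simp_all add: expoly_def algebra_simps)

lemma expoly_deriv_linear:
  "(expoly_deriv \<nu> ^^ i) (p + q) = (expoly_deriv \<nu> ^^ i) p + (expoly_deriv \<nu> ^^ i) q"
  "(expoly_deriv \<nu> ^^ i) (p - q) = (expoly_deriv \<nu> ^^ i) p - (expoly_deriv \<nu> ^^ i) q"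
  "(expoly_deriv \<nu> ^^ i) (Polynomial.smult c p) = Polynomial.smult c ((expoly_deriv \<nu> ^^ i) p)"
  by (induction i) (simp_all add: expoly_deriv_def pderiv_add pderiv_diff pderiv_smult smult_add_right
      smult_diff_right mult.commute)

lemma exp_bounded_zero [simp]: "exp_bounded b (\<lambda>_. 0)"
  unfolding exp_bounded_def by (rule exI[of _ 0]) simp

lemma exp_bounded_add:
  assumes "exp_bounded b f" "exp_bounded b g"
  shows "exp_bounded b (\<lambda>t. f t + g t)"
proof -
  from assms obtain K L where "\<forall>t\<ge>0. cmod (f t) \<le> K * exp (b * t)" "\<forall>t\<ge>0. cmod (g t) \<le> L * exp (b * t)"
    unfolding exp_bounded_def by blast
  hence "\<forall>t\<ge>0. cmod (f t + g t) \<le> (K + L) * exp (b * t)"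
    by (auto intro!: order_trans[OF norm_triangle_ineq] simp: distrib_right add_mono)
  thus ?thesis unfolding exp_bounded_def by blast
qed

lemma exp_bounded_cmult:
  assumes "exp_bounded b f"
  shows "exp_bounded b (\<lambda>t. c * f t)"
proof -
  from assms obtain K where "\<forall>t\<ge>0. cmod (f t) \<le> K * exp (b * t)"
    unfolding exp_bounded_def by blast
  hence "\<forall>t\<ge>0. cmod (c * f t) \<le> (cmod c * K) * exp (b * t)"
    by (auto simp: norm_mult mult.assoc intro!: mult_left_mono)
  thus ?thesis unfolding exp_bounded_def by blast
qed

lemma exp_bounded_sum:
  assumes "\<And>i. i \<in> I \<Longrightarrow> exp_bounded b (f i)"
  shows "exp_bounded b (\<lambda>t. \<Sum>i\<in>I. f i t)"
  using assms by (induction I rule: infinite_finite_induct) (auto intro: exp_bounded_add)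

lemma exp_bounded_cong:
  assumes "exp_bounded b f" "\<And>t. t \<ge> 0 \<Longrightarrow> g t = f t"
  shows "exp_bounded b g"
  using assms unfolding exp_bounded_def by simp

lemma exp_bounded_mono:
  assumes "exp_bounded b f" "b \<le> c"
  shows "exp_bounded c f"
proof -
  from assms(1) obtain K where K: "\<forall>t\<ge>0. cmod (f t) \<le> K * exp (b * t)"
    unfolding exp_bounded_def by blast
  have "cmod (f t) \<le> \<bar>K\<bar> * exp (c * t)" if "t \<ge> 0" for t
  proof -
    have "cmod (f t) \<le> K * exp (b * t)" using K that by simp
    also have "\<dots> \<le> \<bar>K\<bar> * exp (c * t)"
      using assms(2) that by (intro mult_mono) (auto intro: mult_right_mono)
    finally show ?thesis .
  qed
  thus ?thesis unfolding exp_bounded_def by blast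
qed

text \<open>Half of the exponent absorbs the new factor t, the other half the remaining
  polynomial.\<close>

lemma poly_subexponential:
  fixes q :: "complex poly"
  assumes "\<delta> > 0"
  shows "\<exists>C. \<forall>t\<ge>0. cmod (poly q (of_real t)) \<le> C * exp (\<delta> * t)"
  using assms
proof (induction q arbitrary: \<delta>)
  case 0
  show ?case by (rule exI[of _ 0]) simp
next
  case (pCons a q)
  from pCons.IH[of "\<delta> / 2"] pCons.prems obtain C where
    C: "\<And>t. t \<ge> 0 \<Longrightarrow> cmod (poly q (of_real t)) \<le> C * exp (\<delta> / 2 * t)" by auto
  have "C \<ge> 0" using order_trans[OF norm_ge_zero C[of 0]] by simp
  have "cmod (poly (pCons a q) (of_real t)) \<le> (cmod a + 2 / \<delta> * C) * exp (\<delta> * t)" if "t \<ge> 0" for t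
  proof -
    have "\<delta> / 2 * t \<le> exp (\<delta> / 2 * t)" using exp_ge_add_one_self[of "\<delta> / 2 * t"] by linarith
    hence *: "t \<le> 2 / \<delta> * exp (\<delta> / 2 * t)" using pCons.prems by (simp add: field_simps)
    have "cmod (poly (pCons a q) (of_real t)) \<le> cmod a + t * cmod (poly q (of_real t))"
      using that by (auto intro!: order_trans[OF norm_triangle_ineq] simp: norm_mult)
    also have "\<dots> \<le> cmod a * exp (\<delta> * t) + (2 / \<delta> * exp (\<delta> / 2 * t)) * (C * exp (\<delta> / 2 * t))"
      using that pCons.prems C[OF that] * \<open>C \<ge> 0\<close>
      by (intro add_mono mult_mono) (auto simp: mult_le_cancel_left1)
    also have "\<dots> = (cmod a + 2 / \<delta> * C) * exp (\<delta> * t)"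
      by (simp add: algebra_simps flip: exp_add)
    finally show ?thesis .
  qed
  thus ?case by blast
qed

text \<open>The gap between \<open>Re \<nu>\<close> and \<open>b\<close> absorbs the polynomial
  factor; for nonconstant q the bound with \<open>b = Re \<nu>\<close> would be false.\<close>

lemma exp_bounded_expoly:
  assumes "Re \<nu> < b"
  shows "exp_bounded b (expoly \<nu> q)"
proof -
  from poly_subexponential[of "b - Re \<nu>" q] assms obtain C where
    C: "\<And>t. t \<ge> 0 \<Longrightarrow> cmod (poly q (of_real t)) \<le> C * exp ((b - Re \<nu>) * t)" by auto
  have "cmod (expoly \<nu> q t) \<le> C * exp (b * t)" if "t \<ge> 0" for t
  proof -
    have "cmod (expoly \<nu> q t) \<le> C * exp ((b - Re \<nu>) * t) * exp (Re \<nu> * t)"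
      unfolding expoly_def using C[OF that] by (simp add: norm_mult)
    also have "\<dots> = C * exp (b * t)" by (simp add: algebra_simps flip: exp_add)
    finally show ?thesis .
  qed
  thus ?thesis unfolding exp_bounded_def by blast
qed

text \<open>The fundamental theorem of calculus tolerates finitely many exceptional points in a
  compact interval. There \<open>u'\<close> carries no information, so the integrand is set to 0. In
  the application S consists of the discontinuities of the coefficients.\<close>

lemma has_integral_deriv_locally_finite:
  fixes u :: "real \<Rightarrow> 'a :: banach"
  assumes fin: "\<And>b. finite (S \<inter> {0..b})" and cont: "continuous_on {0..} u"
    and deriv: "\<And>t. t \<ge> 0 \<Longrightarrow> t \<notin> S \<Longrightarrow> (u has_vector_derivative u' t) (at t within {0..})"
    and st: "0 \<le> s" "s \<le> t"
  shows "((\<lambda>r. if r \<in> S then 0 else u' r) has_integral (u t - u s)) {s..t}"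
proof (rule fundamental_theorem_of_calculus_interior_strong[OF fin[of t] st(2)])
  show "continuous_on {s..t} u" by (rule continuous_on_subset[OF cont]) (use st in auto)
  fix r assume r: "r \<in> {s<..<t} - S \<inter> {0..t}"
  hence "at r within {0..} = at r" using st by (intro at_within_interior) (auto simp: interior_Ici[where b = "-1"])
  thus "(u has_vector_derivative (if r \<in> S then 0 else u' r)) (at r)"
    using deriv[of r] r st by auto
qed

text \<open>A mean value inequality with variable bound, obtained by integrating both derivatives.
  The sign condition on \<open>\<phi>'\<close> covers the points of S, where the integrand was set
  to 0.\<close>

lemma increment_bound_locally_finite:
  fixes u :: "real \<Rightarrow> complex"
  assumes fin: "\<And>b. finite (S \<inter> {0..b})" and cont: "continuous_on {0..} u"
    and deriv: "\<And>t. t \<ge> 0 \<Longrightarrow> t \<notin> S \<Longrightarrow> (u has_vector_derivative u' t) (at t within {0..})"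
    and bound: "\<And>t. t \<ge> 0 \<Longrightarrow> t \<notin> S \<Longrightarrow> cmod (u' t) \<le> \<phi>' t"
    and pos: "\<And>t. t \<ge> 0 \<Longrightarrow> 0 \<le> \<phi>' t"
    and \<phi>: "\<And>t. (\<phi> has_vector_derivative \<phi>' t) (at t within {0..})"
    and st: "0 \<le> s" "s \<le> t"
  shows "cmod (u t - u s) \<le> \<phi> t - \<phi> s"
proof -
  have cont\<phi>: "continuous_on {0..} \<phi>"
    by (rule continuous_on_vector_derivative) (rule \<phi>)
  note I = has_integral_deriv_locally_finite[OF fin cont deriv st]
  have J: "(\<phi>' has_integral (\<phi> t - \<phi> s)) {s..t}"
    using has_integral_deriv_locally_finite[of "{}" \<phi> \<phi>', OF _ cont\<phi> \<phi> st] by simp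
  have "norm (integral {s..t} (\<lambda>r. if r \<in> S then 0 else u' r)) \<le> integral {s..t} \<phi>'"
    using bound pos st by (intro integral_norm_bound_integral) (use I J in \<open>auto simp: integrable_on_def\<close>)
  thus ?thesis using I J by (simp add: integral_unique)
qed

lemma mono_locally_finite:
  fixes v :: "real \<Rightarrow> real"
  assumes fin: "\<And>b. finite (S \<inter> {0..b})" and cont: "continuous_on {0..} v"
    and deriv: "\<And>t. t \<ge> 0 \<Longrightarrow> t \<notin> S \<Longrightarrow> (v has_vector_derivative v' t) (at t within {0..})"
    and nonneg: "\<And>t. t \<ge> 0 \<Longrightarrow> t \<notin> S \<Longrightarrow> 0 \<le> v' t"
    and st: "0 \<le> s" "s \<le> t"
  shows "v s \<le> v t"
  using has_integral_nonneg[OF has_integral_deriv_locally_finite[OF fin cont deriv st]] nonneg st by auto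

text \<open>With the integrating factor, u = exp(-a t) y has derivative O(exp(\<gamma> t)) for
  \<gamma> = b - Re a. If \<gamma> > 0, integration from 0 gives the claim with C = 0. If \<gamma> <
  0, u converges, C is its limit and the error is the tail of the integral. For \<gamma> = 0 a
  factor t could appear.\<close>

lemma first_order_exp_bounded:
  fixes y :: "real \<Rightarrow> complex"
  assumes fin: "\<And>b. finite (S \<inter> {0..b})" and cont: "continuous_on {0..} y"
    and deriv: "\<And>t. t \<ge> 0 \<Longrightarrow> t \<notin> S \<Longrightarrow> (y has_vector_derivative y' t) (at t within {0..})"
    and bounded: "exp_bounded b (\<lambda>t. y' t - a * y t)"
    and ne: "Re a \<noteq> b"
  shows "\<exists>C. exp_bounded b (\<lambda>t. y t - C * exp (a * of_real t))"
proof -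
  from bounded obtain K where K: "\<And>t. t \<ge> 0 \<Longrightarrow> cmod (y' t - a * y t) \<le> K * exp (b * t)"
    unfolding exp_bounded_def by blast
  have "K \<ge> 0" using order_trans[OF norm_ge_zero K[of 0]] by simp
  define u where "u t = exp (- a * of_real t) * y t" for t
  define \<gamma> where "\<gamma> = b - Re a"
  have \<gamma>: "\<gamma> \<noteq> 0" using ne by (simp add: \<gamma>_def)
  \<comment> \<open>An antiderivative of the bound for the derivative of u. For \<gamma> < 0 it is
    nonpositive, so its increments from s on are at most -\<phi>(s), which gives the constant M
    below.\<close>
  define \<phi> where "\<phi> t = K / \<gamma> * exp (\<gamma> * t)" for t
  have yu: "y t = exp (a * of_real t) * u t" for t
    by (simp add: u_def exp_minus)
  have incr: "cmod (u t - u s) \<le> \<phi> t - \<phi> s" if "0 \<le> s" "s \<le> t" for s t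
  proof (rule increment_bound_locally_finite[OF fin _ _ _ _ _ that])
    show "continuous_on {0..} u" unfolding u_def by (intro continuous_intros cont)
    show "(u has_vector_derivative exp (- a * of_real t) * (y' t - a * y t)) (at t within {0..})"
      if "t \<ge> 0" "t \<notin> S" for t
    proof -
      have e: "((\<lambda>t. exp (- a * of_real t)) has_vector_derivative - a * exp (- a * of_real t))
          (at t within {0..})"
        using has_vector_derivative_expoly[of "- a" 1 t]
        by (simp add: expoly_def [abs_def] expoly_deriv_def)
      show ?thesis
        unfolding u_def using has_vector_derivative_mult[OF e deriv[OF that]]
        by (simp add: algebra_simps)
    qed
    show "cmod (exp (- a * of_real t) * (y' t - a * y t)) \<le> K * exp (\<gamma> * t)" if "t \<ge> 0" "t \<notin> S" for t
    proof -
      have "cmod (exp (- a * of_real t) * (y' t - a * y t)) \<le> exp (- Re a * t) * (K * exp (b * t))"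
        using K[OF that(1)] by (simp add: norm_mult)
      also have "\<dots> = K * exp (\<gamma> * t)" by (simp add: \<gamma>_def algebra_simps flip: exp_add)
      finally show ?thesis .
    qed
    show "0 \<le> K * exp (\<gamma> * t)" for t using \<open>K \<ge> 0\<close> by simp
    show "(\<phi> has_vector_derivative K * exp (\<gamma> * t)) (at t within {0..})" for t
      unfolding \<phi>_def has_real_derivative_iff_has_vector_derivative[symmetric]
      using \<gamma> by (auto intro!: derivative_eq_intros)
  qed
  have scale: "exp (Re a * t) * exp (\<gamma> * t) = exp (b * t)" for t
    by (simp add: \<gamma>_def algebra_simps flip: exp_add)
  show ?thesis
  proof (cases "\<gamma> > 0")
    case True
    have "cmod (y t) \<le> (cmod (u 0) + K / \<gamma>) * exp (b * t)" if "t \<ge> 0" for t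
    proof -
      have "cmod (u t) \<le> cmod (u 0) + cmod (u t - u 0)" by norm
      also have "\<dots> \<le> cmod (u 0) + \<phi> t"
        using incr[of 0 t] that True \<open>K \<ge> 0\<close> by (simp add: \<phi>_def) (smt (verit) divide_nonneg_pos)
      also have "\<dots> \<le> (cmod (u 0) + K / \<gamma>) * exp (\<gamma> * t)"
        using that True unfolding \<phi>_def distrib_right by (intro add_mono) (auto simp: mult_le_cancel_left1)
      finally have "exp (Re a * t) * cmod (u t) \<le> exp (Re a * t) * ((cmod (u 0) + K / \<gamma>) * exp (\<gamma> * t))"
        by (intro mult_left_mono) auto
      also have "\<dots> = (cmod (u 0) + K / \<gamma>) * exp (b * t)" using scale[of t] by (simp add: mult_ac)
      finally show ?thesis by (simp add: yu norm_mult)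
    qed
    hence "exp_bounded b (\<lambda>t. y t - 0 * exp (a * of_real t))" unfolding exp_bounded_def by auto
    thus ?thesis by blast
  next
    case False
    hence neg: "\<gamma> < 0" using \<gamma> by simp
    define M where "M = K / (- \<gamma>)"
    have "M \<ge> 0" using \<open>K \<ge> 0\<close> neg by (simp add: M_def divide_nonneg_neg)
    have tail: "cmod (u t - u s) \<le> M * exp (\<gamma> * s)" if "0 \<le> s" "s \<le> t" for s t
    proof -
      have "\<phi> t \<le> 0" using neg \<open>K \<ge> 0\<close> by (simp add: \<phi>_def divide_nonneg_neg mult_nonpos_nonneg)
      moreover have "\<phi> s = - M * exp (\<gamma> * s)" by (simp add: \<phi>_def M_def)
      ultimately show ?thesis using incr[OF that] by linarith
    qed
    have "(\<lambda>n. M * exp (\<gamma> * real n)) \<longlonglongrightarrow> M * 0"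
    proof (intro tendsto_mult tendsto_const filterlim_compose[OF exp_at_bot])
      show "filterlim (\<lambda>n. \<gamma> * real n) at_bot sequentially"
        using neg by (intro filterlim_tendsto_neg_mult_at_bot[OF tendsto_const] filterlim_real_sequentially)
    qed
    hence lim0: "(\<lambda>n. M * exp (\<gamma> * real n)) \<longlonglongrightarrow> 0" by simp
    \<comment> \<open>Convergence along the integers is enough, because \<open>tail\<close> compares
      any s with every integer beyond it.\<close>
    have "Cauchy (\<lambda>n. u (real n))"
    proof (rule CauchyI)
      fix e :: real assume "e > 0"
      with lim0 have "\<forall>\<^sub>F n in sequentially. M * exp (\<gamma> * real n) < e / 2"
        by (intro order_tendstoD) auto
      then obtain N where N: "\<And>n. n \<ge> N \<Longrightarrow> M * exp (\<gamma> * real n) < e / 2"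
        unfolding eventually_sequentially by blast
      have "norm (u (real m) - u (real n)) < e" if "m \<ge> N" "n \<ge> N" for m n
      proof -
        have "norm (u (real m) - u (real n)) \<le> cmod (u (real m) - u (real N)) + cmod (u (real n) - u (real N))"
          by norm
        also have "\<dots> < e" using tail[of "real N" "real m"] tail[of "real N" "real n"] that N[of N] by simp
        finally show ?thesis .
      qed
      thus "\<exists>M. \<forall>m\<ge>M. \<forall>n\<ge>M. norm (u (real m) - u (real n)) < e" by blast
    qed
    then obtain C where C: "(\<lambda>n. u (real n)) \<longlonglongrightarrow> C" using Cauchy_convergent convergent_def by blast
    have limit: "cmod (u s - C) \<le> M * exp (\<gamma> * s)" if "s \<ge> 0" for s
    proof (rule Lim_norm_ubound)
      show "(\<lambda>n. u s - u (real n)) \<longlonglongrightarrow> u s - C" by (intro tendsto_intros C)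
      show "\<forall>\<^sub>F n in sequentially. cmod (u s - u (real n)) \<le> M * exp (\<gamma> * s)"
        using eventually_ge_at_top[of "nat \<lceil>s\<rceil>"]
      proof eventually_elim
        case (elim n)
        hence "s \<le> real n" by linarith
        from tail[OF that this] show ?case by (subst norm_minus_commute)
      qed
    qed simp
    have "cmod (y t - C * exp (a * of_real t)) \<le> M * exp (b * t)" if "t \<ge> 0" for t
    proof -
      have "y t - C * exp (a * of_real t) = exp (a * of_real t) * (u t - C)"
        by (simp add: yu algebra_simps)
      hence "cmod (y t - C * exp (a * of_real t)) \<le> exp (Re a * t) * (M * exp (\<gamma> * t))"
        using limit[OF that] by (simp add: norm_mult)
      thus ?thesis using scale[of t] by (simp add: mult_ac)
    qed
    thus ?thesis unfolding exp_bounded_def by blast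
  qed
qed

section \<open>Polynomial coefficients and the expansion of solutions\<close>

lemma pderiv_surj: "\<exists>p. pderiv p = (q :: complex poly)"
proof -
  define p where "p = (\<Sum>i\<le>degree q. monom (coeff q i / of_nat (Suc i)) (Suc i))"
  have "pderiv p = (\<Sum>i\<le>degree q. monom (coeff q i) i)"
    unfolding p_def pderiv_sum by (rule sum.cong) (simp_all add: pderiv_monom del: of_nat_Suc)
  thus ?thesis by (auto simp: poly_as_sum_of_monoms)
qed

lemma pderiv_iter_linear:
  fixes p q :: "complex poly"
  shows "(pderiv ^^ m) (p + q) = (pderiv ^^ m) p + (pderiv ^^ m) q"
    and "(pderiv ^^ m) (Polynomial.smult c p) = Polynomial.smult c ((pderiv ^^ m) p)"
  by (induction m) (simp_all add: pderiv_add pderiv_smult)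

text \<open>If r solves the equation for q', then p = (q - r) / c has derivative r and solves it for
  q. The condition on iterated derivatives encodes degree < m and covers the zero polynomial without
  a case split.\<close>

lemma first_order_poly_solution:
  fixes q :: "complex poly"
  assumes "(pderiv ^^ m) q = 0" "c \<noteq> 0"
  shows "\<exists>p. pderiv p + Polynomial.smult c p = q \<and> (pderiv ^^ m) p = 0"
  using assms(1)
proof (induction m arbitrary: q)
  case 0
  thus ?case by (intro exI[of _ 0]) simp
next
  case (Suc m)
  from Suc.IH[of "pderiv q"] Suc.prems obtain r where
    r: "pderiv r + Polynomial.smult c r = pderiv q" "(pderiv ^^ m) r = 0"
    by (auto simp: funpow_swap1)
  define p where "p = Polynomial.smult (inverse c) (q - r)"
  have "pderiv p = Polynomial.smult (inverse c) (pderiv q - pderiv r)"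
    by (simp add: p_def pderiv_smult pderiv_diff)
  also have "pderiv q - pderiv r = Polynomial.smult c r" using r(1) by (simp add: algebra_simps)
  finally have dp: "pderiv p = r" using assms(2) by simp
  have "pderiv p + Polynomial.smult c p = q" unfolding dp using assms(2) by (simp add: p_def)
  moreover have "(pderiv ^^ Suc m) p = 0" using r(2) dp by (simp add: funpow_swap1)
  ultimately show ?case by blast
qed

lemma pderiv_iter_zero_degree:
  fixes p :: "complex poly"
  assumes "(pderiv ^^ m) p = 0"
  shows "p = 0 \<or> degree p < m"
  using assms
proof (induction m arbitrary: p)
  case (Suc m)
  hence "pderiv p = 0 \<or> degree (pderiv p) < m" by (simp add: funpow_swap1)
  thus ?case by (auto simp: pderiv_eq_0_iff degree_pderiv)
qed simp

lemma degree_prod_linear: "degree (\<Prod>a\<leftarrow>ls. [:- a, 1:]) = length (ls :: complex list)"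
proof (induction ls)
  case (Cons a ls)
  have "(\<Prod>a\<leftarrow>ls. [:- a, 1:]) \<noteq> 0" by (auto simp: prod_list_zero_iff)
  thus ?case using Cons by (simp add: degree_mult_eq del: mult_pCons_left)
qed simp

text \<open>Peeling off one linear factor of the characteristic polynomial at a time turns the equation
  into first-order ones; \<open>p \<nu>\<close> collects the polynomial coefficient of \<open>exp (\<nu>t)\<close>.\<close>

lemma exp_poly_expansion:
  fixes d :: "nat \<Rightarrow> real \<Rightarrow> complex" and ls :: "complex list"
  assumes "\<And>c. finite (S \<inter> {0..c})"
    and "\<And>i. i < length ls \<Longrightarrow> continuous_on {0..} (d i)"
    and "\<And>i t. i < length ls \<Longrightarrow> t \<ge> 0 \<Longrightarrow> t \<notin> S \<Longrightarrow>
      (d i has_vector_derivative d (Suc i) t) (at t within {0..})"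
    and "exp_bounded b (\<lambda>t. \<Sum>i\<le>length ls. coeff (\<Prod>a\<leftarrow>ls. [:- a, 1:]) i * d i t)"
    and "\<And>a. a \<in> set ls \<Longrightarrow> Re a \<noteq> b" and "finite V" "set ls \<subseteq> V"
  shows "\<exists>p. (\<forall>\<nu>. (pderiv ^^ count_list ls \<nu>) (p \<nu>) = 0) \<and>
    (\<forall>\<nu> t. (\<Sum>i\<le>length ls. coeff (\<Prod>a\<leftarrow>ls. [:- a, 1:]) i * expoly \<nu> ((expoly_deriv \<nu> ^^ i) (p \<nu>)) t) = 0) \<and>
    (\<forall>i\<le>length ls. exp_bounded b (\<lambda>t. d i t - (\<Sum>\<nu>\<in>V. expoly \<nu> ((expoly_deriv \<nu> ^^ i) (p \<nu>)) t)))"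
  \<comment> \<open>The index set V stays fixed while \<open>ls\<close> shrinks; for \<nu> outside
    the current list the count is 0, which forces \<open>p \<nu> = 0\<close>.\<close>
  using assms(2-5,7)
proof (induction ls arbitrary: d)
  case Nil
  thus ?case by (intro exI[of _ "\<lambda>_. 0"]) (simp add: expoly_simps)
next
  case (Cons a ls)
  define n where "n = length ls"
  define \<psi> where "\<psi> = (\<Prod>a\<leftarrow>ls. [:- a, 1:])"
  have deg: "degree \<psi> \<le> n" unfolding \<psi>_def n_def by (simp add: degree_prod_linear)
  \<comment> \<open>The sequence \<open>e\<close> is D - a applied to \<open>d\<close>, and it
    satisfies the hypotheses for the shorter list.\<close>
  define e where "e i t = d (Suc i) t - a * d i t" for i t
  have "exp_bounded b (\<lambda>t. \<Sum>i\<le>Suc n. coeff ([:- a, 1:] * \<psi>) i * d i t)"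
    using Cons.prems(3) by (simp only: length_Cons list.map prod_list.Cons n_def \<psi>_def)
  hence "exp_bounded b (\<lambda>t. \<Sum>i\<le>n. coeff \<psi> i * e i t)"
    unfolding poly_operator_linear_factor[OF deg] e_def .
  moreover have "continuous_on {0..} (e i)" if "i < n" for i
    unfolding e_def using Cons.prems(1)[of i] Cons.prems(1)[of "Suc i"] that
    by (auto simp: n_def intro!: continuous_intros)
  moreover have "(e i has_vector_derivative e (Suc i) t) (at t within {0..})"
    if "i < n" "t \<ge> 0" "t \<notin> S" for i t
    unfolding e_def using Cons.prems(2)[of i t] Cons.prems(2)[of "Suc i" t] that
    by (auto simp: n_def intro!: has_vector_derivative_diff has_vector_derivative_mult_right)
  ultimately obtain q where
    q: "\<And>\<nu>. (pderiv ^^ count_list ls \<nu>) (q \<nu>) = 0"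
    and q0: "\<And>\<nu> t. (\<Sum>i\<le>n. coeff \<psi> i * expoly \<nu> ((expoly_deriv \<nu> ^^ i) (q \<nu>)) t) = 0"
    and qe: "\<And>i. i \<le> n \<Longrightarrow>
      exp_bounded b (\<lambda>t. e i t - (\<Sum>\<nu>\<in>V. expoly \<nu> ((expoly_deriv \<nu> ^^ i) (q \<nu>)) t))"
    using Cons.IH[of e] Cons.prems(4,5) unfolding n_def \<psi>_def by auto
  \<comment> \<open>Inverting D - a on q exp(\<nu> t) means solving p' + (\<nu> - a) p = q. In the
    resonant case \<nu> = a an antiderivative may raise the degree by one, which the increased count
    permits; otherwise the degree bound is kept.\<close>
  have "\<exists>p. pderiv p + Polynomial.smult (\<nu> - a) p = q \<nu> \<and> (pderiv ^^ count_list (a # ls) \<nu>) p = 0" for \<nu>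
  proof (cases "\<nu> = a")
    case True
    obtain p where "pderiv p = q \<nu>" using pderiv_surj by blast
    thus ?thesis using True q[of \<nu>] by (intro exI[of _ p]) (simp add: funpow_swap1)
  next
    case False
    thus ?thesis using first_order_poly_solution[OF q, of "\<nu> - a" \<nu>] by auto
  qed
  then obtain r where r: "\<And>\<nu>. pderiv (r \<nu>) + Polynomial.smult (\<nu> - a) (r \<nu>) = q \<nu>"
    "\<And>\<nu>. (pderiv ^^ count_list (a # ls) \<nu>) (r \<nu>) = 0" by metis
  have dr: "expoly_deriv \<nu> (r \<nu>) - Polynomial.smult a (r \<nu>) = q \<nu>" for \<nu>
    using r(1)[of \<nu>] by (simp add: expoly_deriv_def algebra_simps smult_diff_left)
  \<comment> \<open>Subtracting the particular solution with coefficients r leaves a function that D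
    - a maps to O(exp(b t)). Up to that order it is a multiple of exp(a t), which is then added to
    the coefficient for \<nu> = a.\<close>
  define w where "w t = d 0 t - (\<Sum>\<nu>\<in>V. expoly \<nu> (r \<nu>) t)" for t
  define w' where "w' t = d 1 t - (\<Sum>\<nu>\<in>V. expoly \<nu> (expoly_deriv \<nu> (r \<nu>)) t)" for t
  have "\<exists>C. exp_bounded b (\<lambda>t. w t - C * exp (a * of_real t))"
  proof (rule first_order_exp_bounded[OF assms(1)])
    have "continuous_on {0..} (expoly \<nu> (r \<nu>))" for \<nu>
      by (rule continuous_on_vector_derivative) (rule has_vector_derivative_expoly)
    thus "continuous_on {0..} w" unfolding w_def
      using Cons.prems(1)[of 0] by (auto intro!: continuous_intros)
    show "(w has_vector_derivative w' t) (at t within {0..})" if "t \<ge> 0" "t \<notin> S" for t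
      unfolding w_def w'_def using Cons.prems(2)[of 0 t] that
      by (auto intro!: has_vector_derivative_diff has_vector_derivative_sum has_vector_derivative_expoly)
    have "w' t - a * w t = e 0 t - (\<Sum>\<nu>\<in>V. expoly \<nu> (q \<nu>) t)" for t
      unfolding dr[symmetric]
      by (simp add: w'_def w_def e_def expoly_simps sum_subtractf sum_distrib_left algebra_simps)
    thus "exp_bounded b (\<lambda>t. w' t - a * w t)" using qe[of 0] by simp
    show "Re a \<noteq> b" using Cons.prems(4) by simp
  qed
  then obtain C where C: "exp_bounded b (\<lambda>t. w t - C * exp (a * of_real t))" by blast
  define p where "p \<nu> = r \<nu> + (if \<nu> = a then [:C:] else 0)" for \<nu>
  have p: "(pderiv ^^ count_list (a # ls) \<nu>) (p \<nu>) = 0" for \<nu>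
  proof -
    have "(pderiv ^^ m) (0 :: complex poly) = 0" for m by (induction m) simp_all
    thus ?thesis unfolding p_def pderiv_iter_linear r(2) by (simp add: funpow_swap1)
  qed
  have dp: "expoly_deriv \<nu> (p \<nu>) = q \<nu> + Polynomial.smult a (p \<nu>)" for \<nu>
    unfolding dr[symmetric] by (simp add: p_def expoly_deriv_def pderiv_add smult_add_right)
  have step: "expoly \<nu> ((expoly_deriv \<nu> ^^ Suc i) (p \<nu>)) t =
      expoly \<nu> ((expoly_deriv \<nu> ^^ i) (q \<nu>)) t + a * expoly \<nu> ((expoly_deriv \<nu> ^^ i) (p \<nu>)) t" for i \<nu> t
    unfolding funpow_Suc_right o_def dp expoly_deriv_linear expoly_simps ..
  have "(\<Sum>i\<le>Suc n. coeff ([:- a, 1:] * \<psi>) i * expoly \<nu> ((expoly_deriv \<nu> ^^ i) (p \<nu>)) t) = 0" for \<nu> t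
    unfolding poly_operator_linear_factor[OF deg] step using q0[of \<nu> t] by simp
  moreover have "exp_bounded b (\<lambda>t. d i t - (\<Sum>\<nu>\<in>V. expoly \<nu> ((expoly_deriv \<nu> ^^ i) (p \<nu>)) t))"
    if "i \<le> Suc n" for i
    using that
  proof (induction i)
    case 0
    have "(\<Sum>\<nu>\<in>V. expoly \<nu> (if \<nu> = a then [:C:] else 0) t) = C * exp (a * of_real t)" for t
    proof -
      have "(\<Sum>\<nu>\<in>V. expoly \<nu> (if \<nu> = a then [:C:] else 0) t) =
          (\<Sum>\<nu>\<in>V. if \<nu> = a then C * exp (a * of_real t) else 0)"
        by (rule sum.cong) (auto simp: expoly_def)
      thus ?thesis using Cons.prems(5) assms(6) by simp
    qed
    thus ?case using C by (simp add: w_def p_def expoly_simps sum.distrib algebra_simps)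
  next
    case (Suc i)
    \<comment> \<open>Since \<open>d (Suc i) = e i + a * d i\<close>, the estimates for higher
      derivatives come from those for \<open>e\<close>; no estimate is differentiated.\<close>
    have "exp_bounded b (\<lambda>t. (e i t - (\<Sum>\<nu>\<in>V. expoly \<nu> ((expoly_deriv \<nu> ^^ i) (q \<nu>)) t)) +
        a * (d i t - (\<Sum>\<nu>\<in>V. expoly \<nu> ((expoly_deriv \<nu> ^^ i) (p \<nu>)) t)))"
      using Suc by (intro exp_bounded_add exp_bounded_cmult qe) auto
    thus ?case
      unfolding step by (simp add: e_def sum.distrib sum_distrib_left algebra_simps)
  qed
  ultimately show ?case using p unfolding n_def \<psi>_def by (intro exI[of _ p]) simp
qed

section \<open>The dominant part of a solution\<close>

text \<open>A two-sided Gronwall estimate: |N'| \<le> K N makes N exp(K t) nondecreasing and N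
  exp(-K t) nonincreasing. The lower bound excludes decay faster than every exponential, the upper
  one gives an initial growth rate.\<close>

lemma energy_bounds:
  fixes d :: "nat \<Rightarrow> real \<Rightarrow> complex"
  assumes fin: "\<And>c. finite (S \<inter> {0..c})"
    and cont: "\<And>i. i < n \<Longrightarrow> continuous_on {0..} (d i)"
    and deriv: "\<And>i t. i < n \<Longrightarrow> t \<ge> 0 \<Longrightarrow> t \<notin> S \<Longrightarrow>
      (d i has_vector_derivative d (Suc i) t) (at t within {0..})"
    and bound: "\<And>t. t \<ge> 0 \<Longrightarrow> t \<notin> S \<Longrightarrow> cmod (d n t) \<le> A * (\<Sum>i<n. cmod (d i t))"
  defines "N \<equiv> \<lambda>t. \<Sum>i<n. (cmod (d i t))\<^sup>2"
  shows "\<exists>K. \<forall>t\<ge>0. N 0 * exp (- K * t) \<le> N t \<and> N t \<le> N 0 * exp (K * t)"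
proof -
  \<comment> \<open>The products of neighbouring derivatives contribute at most 2 N plus the square
    of the n-th derivative, and Cauchy-Schwarz bounds that square by
    \<open>A\<^sup>2 * n * N\<close>.\<close>
  define K where "K = 2 + A\<^sup>2 * n"
  define N' where "N' t = (\<Sum>i<n. 2 * (d i t \<bullet> d (Suc i) t))" for t
  have contN: "continuous_on {0..} N"
    unfolding N_def by (intro continuous_intros cont) simp
  have derivN: "(N has_vector_derivative N' t) (at t within {0..})" if "t \<ge> 0" "t \<notin> S" for t
    unfolding N_def N'_def power2_norm_eq_inner
  proof (rule has_vector_derivative_sum)
    fix i assume "i \<in> {..<n}"
    hence "(d i has_vector_derivative d (Suc i) t) (at t within {0..})" using deriv that by simp
    from bounded_bilinear.has_vector_derivative[OF bounded_bilinear_inner this this]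
    show "((\<lambda>t. d i t \<bullet> d i t) has_vector_derivative 2 * (d i t \<bullet> d (Suc i) t)) (at t within {0..})"
      by (simp add: inner_commute)
  qed
  have N': "\<bar>N' t\<bar> \<le> K * N t" if "t \<ge> 0" "t \<notin> S" for t
  proof -
    have "\<bar>N' t\<bar> \<le> (\<Sum>i<n. (cmod (d i t))\<^sup>2 + (cmod (d (Suc i) t))\<^sup>2)"
      unfolding N'_def
    proof (intro order_trans[OF sum_abs] sum_mono)
      fix i
      have "\<bar>d i t \<bullet> d (Suc i) t\<bar> \<le> cmod (d i t) * cmod (d (Suc i) t)" by (rule Cauchy_Schwarz_ineq2)
      thus "\<bar>2 * (d i t \<bullet> d (Suc i) t)\<bar> \<le> (cmod (d i t))\<^sup>2 + (cmod (d (Suc i) t))\<^sup>2"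
        using sum_squares_bound[of "cmod (d i t)" "cmod (d (Suc i) t)"] by simp
    qed
    also have "\<dots> = N t + (\<Sum>i<n. (cmod (d (Suc i) t))\<^sup>2)" by (simp add: N_def sum.distrib)
    also have "(\<Sum>i<n. (cmod (d (Suc i) t))\<^sup>2) \<le> (\<Sum>i<Suc n. (cmod (d i t))\<^sup>2)"
      by (simp add: sum.lessThan_Suc_shift del: sum.lessThan_Suc)
    also have "\<dots> = N t + (cmod (d n t))\<^sup>2" by (simp add: N_def)
    also have "(cmod (d n t))\<^sup>2 \<le> (A * (\<Sum>i<n. cmod (d i t)))\<^sup>2"
      using bound[OF that] by (rule power_mono) simp
    also have "\<dots> \<le> A\<^sup>2 * (N t * n)"
      unfolding power_mult_distrib N_def
      using sum_squared_le_sum_of_squares[of "\<lambda>i. cmod (d i t)" "{..<n}"]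
      by (intro mult_left_mono) auto
    finally show ?thesis by (simp add: K_def algebra_simps)
  qed
  have expd: "((\<lambda>t. exp (c * t)) has_vector_derivative c * exp (c * t)) (at t within {0..})" for c t :: real
    unfolding has_real_derivative_iff_has_vector_derivative[symmetric]
    by (auto intro!: derivative_eq_intros)
  have "N 0 * exp (- K * t) \<le> N t \<and> N t \<le> N 0 * exp (K * t)" if "t \<ge> 0" for t
  proof
    have "N 0 * exp (K * 0) \<le> N t * exp (K * t)"
    proof (rule mono_locally_finite[OF fin, where v = "\<lambda>t. N t * exp (K * t)"])
      show "continuous_on {0..} (\<lambda>t. N t * exp (K * t))" by (intro continuous_intros contN)
      show "((\<lambda>t. N t * exp (K * t)) has_vector_derivative N t * (K * exp (K * t)) + N' t * exp (K * t))
          (at t within {0..})" if "t \<ge> 0" "t \<notin> S" for t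
        by (rule has_vector_derivative_mult[OF derivN[OF that] expd])
      show "0 \<le> N t * (K * exp (K * t)) + N' t * exp (K * t)" if "t \<ge> 0" "t \<notin> S" for t
      proof -
        have "0 \<le> (K * N t + N' t) * exp (K * t)" using N'[OF that] by (intro mult_nonneg_nonneg) auto
        thus ?thesis by (simp add: algebra_simps)
      qed
    qed (use that in auto)
    thus "N 0 * exp (- K * t) \<le> N t" by (simp add: exp_minus field_simps)
    have "- N 0 * exp (- K * 0) \<le> - N t * exp (- K * t)"
    proof (rule mono_locally_finite[OF fin, where v = "\<lambda>t. - N t * exp (- K * t)"])
      show "continuous_on {0..} (\<lambda>t. - N t * exp (- K * t))" by (intro continuous_intros contN)
      show "((\<lambda>t. - N t * exp (- K * t)) has_vector_derivative
          - N t * (- K * exp (- K * t)) + - N' t * exp (- K * t)) (at t within {0..})"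
        if "t \<ge> 0" "t \<notin> S" for t
        by (rule has_vector_derivative_mult[OF has_vector_derivative_minus[OF derivN[OF that]] expd])
      show "0 \<le> - N t * (- K * exp (- K * t)) + - N' t * exp (- K * t)" if "t \<ge> 0" "t \<notin> S" for t
      proof -
        have "0 \<le> (K * N t - N' t) * exp (- K * t)" using N'[OF that] by (intro mult_nonneg_nonneg) auto
        thus ?thesis by (simp add: algebra_simps)
      qed
    qed (use that in auto)
    thus "N t \<le> N 0 * exp (K * t)" by (simp add: exp_minus field_simps)
  qed
  thus ?thesis by blast
qed

text \<open>The expansion is grouped by real parts of the roots. If all groups above b vanished,
  every \<open>d i\<close> would be O(exp(b t)), against \<open>large\<close>. So a largest real
  part with a nonzero group exists, and all other terms grow strictly more slowly.\<close>

lemma principal_part: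
  fixes d :: "nat \<Rightarrow> real \<Rightarrow> complex" and ls :: "complex list"
  assumes fin: "\<And>c. finite (S \<inter> {0..c})"
    and cont: "\<And>i. i < length ls \<Longrightarrow> continuous_on {0..} (d i)"
    and deriv: "\<And>i t. i < length ls \<Longrightarrow> t \<ge> 0 \<Longrightarrow> t \<notin> S \<Longrightarrow>
      (d i has_vector_derivative d (Suc i) t) (at t within {0..})"
    and small: "exp_bounded b (\<lambda>t. \<Sum>i\<le>length ls. coeff (\<Prod>a\<leftarrow>ls. [:- a, 1:]) i * d i t)"
    and ne: "\<And>a. a \<in> set ls \<Longrightarrow> Re a \<noteq> b"
    and large: "\<exists>i\<le>length ls. \<not> exp_bounded b (d i)"
  obtains \<rho> b' p where "b' < \<rho>"
    and "\<And>\<nu>. (pderiv ^^ count_list ls \<nu>) (p \<nu>) = 0"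
    and "\<And>\<nu> t. (\<Sum>i\<le>length ls. coeff (\<Prod>a\<leftarrow>ls. [:- a, 1:]) i * expoly \<nu> ((expoly_deriv \<nu> ^^ i) (p \<nu>)) t) = 0"
    and "\<exists>t\<ge>0. (\<Sum>\<nu> | \<nu> \<in> set ls \<and> Re \<nu> = \<rho>. expoly \<nu> (p \<nu>) t) \<noteq> 0"
    and "exp_bounded b' (\<lambda>t. d 0 t - (\<Sum>\<nu> | \<nu> \<in> set ls \<and> Re \<nu> = \<rho>. expoly \<nu> (p \<nu>) t))"
proof -
  have "\<exists>p. (\<forall>\<nu>. (pderiv ^^ count_list ls \<nu>) (p \<nu>) = 0) \<and>
      (\<forall>\<nu> t. (\<Sum>i\<le>length ls. coeff (\<Prod>a\<leftarrow>ls. [:- a, 1:]) i * expoly \<nu> ((expoly_deriv \<nu> ^^ i) (p \<nu>)) t) = 0) \<and>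
      (\<forall>i\<le>length ls. exp_bounded b (\<lambda>t. d i t - (\<Sum>\<nu>\<in>set ls. expoly \<nu> ((expoly_deriv \<nu> ^^ i) (p \<nu>)) t)))"
    by (rule exp_poly_expansion[OF fin cont deriv small ne]) simp_all
  then obtain p where
    p: "\<And>\<nu>. (pderiv ^^ count_list ls \<nu>) (p \<nu>) = 0"
    and p0: "\<And>\<nu> t. (\<Sum>i\<le>length ls. coeff (\<Prod>a\<leftarrow>ls. [:- a, 1:]) i * expoly \<nu> ((expoly_deriv \<nu> ^^ i) (p \<nu>)) t) = 0"
    and pb: "\<And>i. i \<le> length ls \<Longrightarrow>
      exp_bounded b (\<lambda>t. d i t - (\<Sum>\<nu>\<in>set ls. expoly \<nu> ((expoly_deriv \<nu> ^^ i) (p \<nu>)) t))"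
    by blast
  define R where "R = Re ` set ls"
  have "finite R" by (simp add: R_def)
  define H where "H i r t = (\<Sum>\<nu> | \<nu> \<in> set ls \<and> Re \<nu> = r. expoly \<nu> ((expoly_deriv \<nu> ^^ i) (p \<nu>)) t)" for i r t
  have split: "(\<Sum>\<nu>\<in>set ls. expoly \<nu> ((expoly_deriv \<nu> ^^ i) (p \<nu>)) t) = (\<Sum>r\<in>R. H i r t)" for i t
    unfolding H_def by (rule sum.group[symmetric]) (auto simp: R_def)
  have low: "exp_bounded c (H i r)" if "r < c" for i r c
    unfolding H_def [abs_def] using that by (intro exp_bounded_sum exp_bounded_expoly) auto
  define G where "G = {r \<in> R. r > b \<and> (\<exists>t\<ge>0. H 0 r t \<noteq> 0)}"
  have "G \<noteq> {}"
  proof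
    assume "G = {}"
    \<comment> \<open>A group vanishing on [0, infinity) has vanishing derivatives there. All orders
      are needed, because \<open>large\<close> does not say which derivative violates the
      bound.\<close>
    have zero: "\<forall>t\<ge>0. H i r t = 0" if "r \<in> R" "r > b" for i r
    proof (induction i)
      case 0
      show ?case using that \<open>G = {}\<close> by (auto simp: G_def)
    next
      case (Suc i)
      show ?case
      proof (intro allI impI)
        fix t :: real assume t: "t \<ge> 0"
        have "(H i r has_vector_derivative H (Suc i) r t) (at t within {0..})"
          unfolding H_def [abs_def] funpow.simps o_def
          by (intro has_vector_derivative_sum has_vector_derivative_expoly)
        moreover have "(H i r has_vector_derivative 0) (at t within {0..})"
          by (rule has_vector_derivative_transform[where f = "\<lambda>_. 0"]) (use t Suc in auto)
        \<comment> \<open>This makes derivatives unique, also the one-sided one at t = 0.\<close>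
        moreover have "at t within {0..} \<noteq> bot"
        proof -
          have "at_right t \<le> at t within {0..}" using t by (intro at_le) auto
          thus ?thesis using trivial_limit_at_right_real[of t] bot.extremum_uniqueI by metis
        qed
        ultimately show "H (Suc i) r t = 0" by (meson vector_derivative_unique_within)
      qed
    qed
    have "exp_bounded b (H i r)" if "r \<in> R" for i r
    proof (cases "r < b")
      case True
      thus ?thesis by (rule low)
    next
      case False
      hence "r > b" using that ne unfolding R_def by fastforce
      thus ?thesis using zero[OF that] by (intro exp_bounded_cong[OF exp_bounded_zero]) auto
    qed
    hence "exp_bounded b (\<lambda>t. (d i t - (\<Sum>r\<in>R. H i r t)) + (\<Sum>r\<in>R. H i r t))" if "i \<le> length ls" for i
      using pb[OF that] unfolding split by (intro exp_bounded_add exp_bounded_sum) auto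
    thus False using large by auto
  qed
  define \<rho> where "\<rho> = Max G"
  have "finite G" using \<open>finite R\<close> by (simp add: G_def)
  have "\<rho> \<in> G" unfolding \<rho>_def using \<open>finite G\<close> \<open>G \<noteq> {}\<close> by (rule Max_in)
  \<comment> \<open>The largest competing rate. Groups with real part m may carry polynomial
    factors, so b' is taken strictly between m and \<rho>.\<close>
  define m where "m = Max (insert b {r \<in> R. r < \<rho>})"
  have m: "m < \<rho>" "b \<le> m" "\<And>r. r \<in> R \<Longrightarrow> r < \<rho> \<Longrightarrow> r \<le> m"
    using \<open>\<rho> \<in> G\<close> \<open>finite R\<close> by (auto simp: m_def G_def)
  define b' where "b' = (m + \<rho>) / 2"
  have b': "m < b'" "b' < \<rho>" using m(1) by (auto simp: b'_def)
  have "exp_bounded b' (H 0 r)" if "r \<in> R - {\<rho>}" for r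
  proof (cases "r < \<rho>")
    case True
    thus ?thesis using m(3)[of r] that b' by (intro low) auto
  next
    case False
    \<comment> \<open>By maximality of \<rho>, groups with larger real part vanish on [0,
      infinity).\<close>
    hence "r > \<rho>" using that by auto
    hence "r \<notin> G" using Max_ge[OF \<open>finite G\<close>, of r] unfolding \<rho>_def by auto
    hence "\<forall>t\<ge>0. H 0 r t = 0" using that \<open>r > \<rho>\<close> \<open>\<rho> \<in> G\<close> by (auto simp: G_def)
    thus ?thesis by (intro exp_bounded_cong[OF exp_bounded_zero]) auto
  qed
  hence "exp_bounded b' (\<lambda>t. (d 0 t - (\<Sum>r\<in>R. H 0 r t)) + (\<Sum>r\<in>R - {\<rho>}. H 0 r t))"
    using pb[of 0] m(2) b'(1) unfolding split
    by (intro exp_bounded_add exp_bounded_sum) (auto elim: exp_bounded_mono)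
  moreover have "(\<Sum>r\<in>R. H 0 r t) = H 0 \<rho> t + (\<Sum>r\<in>R - {\<rho>}. H 0 r t)" for t
    using \<open>finite R\<close> \<open>\<rho> \<in> G\<close> by (intro sum.remove) (auto simp: G_def)
  ultimately have "exp_bounded b' (\<lambda>t. d 0 t - H 0 \<rho> t)" by simp
  moreover have "\<exists>t\<ge>0. H 0 \<rho> t \<noteq> 0" using \<open>\<rho> \<in> G\<close> by (auto simp: G_def)
  ultimately show thesis using that[OF b'(2) p p0] unfolding H_def by simp
qed

section \<open>Sampling\<close>

lemma coeff_char_poly_companion_matrix:
  assumes "a 0 = 1" "i \<le> n"
  shows "coeff (char_poly (companion_matrix n a)) i = a (n - i)"
  using assms unfolding char_poly_companion_matrix
  by (cases "i = n") (auto simp: coeff_sum sum.delta)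

text \<open>At t = k T the factor exp(\<nu> t) becomes z^k with z = exp(T \<nu>). Several \<nu> may
  share one z, so their polynomials, rescaled by T, are summed. Each has degree below the
  multiplicity of its \<nu>, hence below that of z.\<close>

lemma char_solution_set_sampled_expoly:
  fixes T :: real
  assumes P: "P = (\<Prod>a\<leftarrow>ls. [:- exp (complex_of_real T * a), 1:])"
    and p: "\<And>\<nu>. (pderiv ^^ count_list ls \<nu>) (p \<nu>) = 0"
  shows "char_solution_set P {z. poly P z = 0 \<and> cmod z = exp (\<rho> * T)}
    (\<lambda>k. \<Sum>\<nu> | \<nu> \<in> set ls \<and> Re \<nu> = \<rho>. expoly \<nu> (p \<nu>) (real k * T))"
proof -
  define V where "V = {\<nu> \<in> set ls. Re \<nu> = \<rho>}"
  define g where "g \<nu> = exp (complex_of_real T * \<nu>)" for \<nu>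
  define s where "s z = (\<Sum>\<nu> | \<nu> \<in> V \<and> g \<nu> = z. p \<nu> \<circ>\<^sub>p [:0, complex_of_real T:])" for z
  define w where "w z k = poly (s z) (of_nat k) * z ^ k" for z :: complex and k :: nat
  have "finite V" by (simp add: V_def)
  have "P \<noteq> 0" unfolding P by (rule prod_list_linear_nonzero)
  have char: "char_solution P z (w z)" if "z \<in> g ` V" for z
  proof (rule char_solutionI[OF \<open>P \<noteq> 0\<close> _ w_def])
    have deg: "degree (p \<nu> \<circ>\<^sub>p [:0, complex_of_real T:]) < Polynomial.order z P"
      if "\<nu> \<in> V" "g \<nu> = z" for \<nu>
    proof -
      have "count_list ls \<nu> > 0" using that(1) count_list_0_iff[of ls \<nu>] by (auto simp: V_def)
      hence "degree (p \<nu>) < count_list ls \<nu>" using pderiv_iter_zero_degree[OF p[of \<nu>]] by auto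
      moreover have "count_list ls \<nu> \<le> Polynomial.order z P"
        using count_le_order_exp[OF P, of \<nu>] that(2) by (simp add: g_def)
      moreover have "degree (p \<nu> \<circ>\<^sub>p [:0, complex_of_real T:]) \<le> degree (p \<nu>)"
        by (cases "T = 0") auto
      ultimately show ?thesis by linarith
    qed
    obtain \<nu> where "\<nu> \<in> V" "g \<nu> = z" using \<open>z \<in> g ` V\<close> by blast
    from le_less_trans[OF le0 deg[OF this]] have "0 < Polynomial.order z P" .
    thus "degree (s z) < Polynomial.order z P"
      unfolding s_def by (intro degree_sum_less deg) auto
  qed
  have sub: "g ` V \<subseteq> {z. poly P z = 0 \<and> cmod z = exp (\<rho> * T)}"
    using char by (auto simp: char_solution_def) (auto simp: V_def g_def mult.commute)
  have "(\<Sum>\<nu>\<in>V. expoly \<nu> (p \<nu>) (real k * T)) = (\<Sum>z\<in>g ` V. w z k)" for k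
  proof -
    have "w z k = (\<Sum>\<nu> | \<nu> \<in> V \<and> g \<nu> = z. expoly \<nu> (p \<nu>) (real k * T))" for z
    proof -
      have "poly (p \<nu> \<circ>\<^sub>p [:0, complex_of_real T:]) (of_nat k) * z ^ k = expoly \<nu> (p \<nu>) (real k * T)"
        if "g \<nu> = z" for \<nu>
        unfolding that[symmetric] g_def expoly_def exp_of_nat_mult[symmetric]
        by (simp add: poly_pcompose mult_ac)
      thus ?thesis unfolding w_def s_def poly_sum sum_distrib_right by (intro sum.cong) auto
    qed
    thus ?thesis
      using sum.group[of V "g ` V" g "\<lambda>\<nu>. expoly \<nu> (p \<nu>) (real k * T)"] \<open>finite V\<close> by simp
  qed
  hence "finite (g ` V) \<and> g ` V \<subseteq> {z. poly P z = 0 \<and> cmod z = exp (\<rho> * T)} \<and>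
      (\<forall>z\<in>g ` V. char_solution P z (w z)) \<and>
      (\<forall>k. (\<Sum>\<nu>\<in>V. expoly \<nu> (p \<nu>) (real k * T)) = (\<Sum>z\<in>g ` V. w z k))"
    using char sub \<open>finite V\<close> by blast
  thus ?thesis unfolding char_solution_set_def V_def[symmetric] by blast
qed

section \<open>Coefficient errors, constant-coefficient solutions and sampled bounds\<close>

lemma exp_bounded_mult:
  assumes "exp_bounded b f" "exp_bounded c g"
  shows "exp_bounded (b + c) (\<lambda>t. f t * g t)"
proof -
  from assms obtain K L where K: "\<forall>t\<ge>0. cmod (f t) \<le> K * exp (b * t)"
    and L: "\<forall>t\<ge>0. cmod (g t) \<le> L * exp (c * t)"
    unfolding exp_bounded_def by blast
  have "cmod (f t * g t) \<le> (K * L) * exp ((b + c) * t)" if "t \<ge> 0" for t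
  proof -
    have "cmod (f t * g t) \<le> (K * exp (b * t)) * (L * exp (c * t))"
      unfolding norm_mult using K L that order_trans[OF norm_ge_zero] by (intro mult_mono) auto
    thus ?thesis by (simp add: exp_add algebra_simps)
  qed
  thus ?thesis unfolding exp_bounded_def by blast
qed

lemma exp_bounded_dominated:
  assumes "exp_bounded b f" "\<And>t. t \<ge> 0 \<Longrightarrow> cmod (g t) \<le> cmod (f t)"
  shows "exp_bounded b g"
  using assms unfolding exp_bounded_def by (meson order_trans)

text \<open>The little-o condition only acts beyond some t0. Before t0 boundedness of f suffices,
  and the factor exp(|\<sigma>| |t0|) in M compensates for exp(-\<sigma> t) there.\<close>

lemma exp_bounded_coefficient_error:
  fixes f :: "real \<Rightarrow> complex"
  assumes "bounded (f ` {0..})" "(\<lambda>t. f t - l) \<in> o[at_top](\<lambda>t. complex_of_real (exp (- \<sigma> * t)))"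
  shows "exp_bounded (- \<sigma>) (\<lambda>t. f t - l)"
proof -
  from landau_o.smallD[OF assms(2), of 1] obtain t0 where
    t0: "\<And>t. t \<ge> t0 \<Longrightarrow> cmod (f t - l) \<le> exp (- \<sigma> * t)"
    unfolding eventually_at_top_linorder by auto
  from assms(1) obtain B where B: "\<And>t. t \<ge> 0 \<Longrightarrow> cmod (f t) \<le> B"
    unfolding bounded_iff by auto
  have "B \<ge> 0" using order_trans[OF norm_ge_zero B[of 0]] by simp
  define M where "M = 1 + (B + cmod l) * exp (\<bar>\<sigma>\<bar> * \<bar>t0\<bar>)"
  have "cmod (f t - l) \<le> M * exp (- \<sigma> * t)" if "t \<ge> 0" for t
  proof (cases "t \<ge> t0")
    case True
    have "exp (- \<sigma> * t) \<le> M * exp (- \<sigma> * t)" using \<open>B \<ge> 0\<close> by (simp add: M_def)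
    thus ?thesis using t0[OF True] by linarith
  next
    case False
    have "\<sigma> * t \<le> \<bar>\<sigma>\<bar> * \<bar>t0\<bar>" using False that
      by (intro mult_mono) auto
    hence ge1: "1 \<le> exp (\<bar>\<sigma>\<bar> * \<bar>t0\<bar>) * exp (- \<sigma> * t)" by (simp flip: exp_add)
    have "cmod (f t - l) \<le> (B + cmod l) * 1" using B[OF that] norm_triangle_ineq4[of "f t" l] by simp
    also have "\<dots> \<le> (B + cmod l) * (exp (\<bar>\<sigma>\<bar> * \<bar>t0\<bar>) * exp (- \<sigma> * t))"
      using \<open>B \<ge> 0\<close> ge1 by (intro mult_left_mono) auto
    also have "\<dots> \<le> M * exp (- \<sigma> * t)" by (simp add: M_def algebra_simps)
    finally show ?thesis .
  qed
  thus ?thesis unfolding exp_bounded_def by blast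
qed

lemma ode_solution_expoly_sum:
  assumes "n \<ge> 1"
    and "\<And>\<nu> t. (\<Sum>i\<le>n. a (n - i) * expoly \<nu> ((expoly_deriv \<nu> ^^ i) (p \<nu>)) t) = 0"
  shows "ode_solution n (\<lambda>j _. a j) (\<lambda>t. \<Sum>\<nu>\<in>V. expoly \<nu> (p \<nu>) t)"
proof -
  define d where "d i t = (\<Sum>\<nu>\<in>V. expoly \<nu> ((expoly_deriv \<nu> ^^ i) (p \<nu>)) t)" for i t
  have deriv: "(d i has_vector_derivative d (Suc i) t) (at t within {0..})" for i t
    unfolding d_def funpow.simps o_def
    by (intro has_vector_derivative_sum has_vector_derivative_expoly)
  have "(\<Sum>i\<le>n. a (n - i) * d i t) = 0" for t
  proof -
    have "(\<Sum>i\<le>n. a (n - i) * d i t) =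
        (\<Sum>\<nu>\<in>V. \<Sum>i\<le>n. a (n - i) * expoly \<nu> ((expoly_deriv \<nu> ^^ i) (p \<nu>)) t)"
      unfolding d_def sum_distrib_left by (rule sum.swap)
    thus ?thesis by (simp add: assms(2))
  qed
  moreover have "continuous_on {0..} (d (n - 1))"
    by (rule continuous_on_vector_derivative) (rule deriv)
  ultimately show ?thesis
    unfolding ode_solution_def
    by (intro exI[of _ d]) (use deriv deriv[of "n - 1"] assms(1) in \<open>simp add: d_def [abs_def]\<close>)
qed

text \<open>The factor exp(b \<tau>) is at most exp(|b| T) for all \<tau> in [0, T), whatever the
  sign of b. The principal filter in the product makes the estimate uniform in \<tau>.\<close>

lemma exp_bounded_imp_bigo_samples:
  assumes "exp_bounded b f" "T > 0"
  shows "(\<lambda>(k, \<tau>). f (real k * T + \<tau>)) \<in>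
    O[sequentially \<times>\<^sub>F principal {0..<T}](\<lambda>(k, \<tau>). complex_of_real (exp (b * T) ^ k))"
proof -
  from assms(1) obtain K where K: "\<And>t. t \<ge> 0 \<Longrightarrow> cmod (f t) \<le> K * exp (b * t)"
    unfolding exp_bounded_def by blast
  have "K \<ge> 0" using order_trans[OF norm_ge_zero K[of 0]] by simp
  have "cmod (f (real k * T + \<tau>)) \<le> K * exp (\<bar>b\<bar> * T) * cmod (complex_of_real (exp (b * T) ^ k))"
    if "0 \<le> \<tau>" "\<tau> < T" for k \<tau>
  proof -
    have "cmod (f (real k * T + \<tau>)) \<le> K * exp (b * (real k * T + \<tau>))"
      using that assms(2) by (intro K) auto
    also have "\<dots> = K * exp (b * \<tau>) * exp (b * T) ^ k"
      by (simp add: exp_of_nat_mult[symmetric] algebra_simps exp_add)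
    also have "b * \<tau> \<le> \<bar>b\<bar> * T"
      using that by (intro mult_mono) auto
    hence "K * exp (b * \<tau>) * exp (b * T) ^ k \<le> K * exp (\<bar>b\<bar> * T) * exp (b * T) ^ k"
      using \<open>K \<ge> 0\<close> by (intro mult_right_mono mult_left_mono) auto
    finally show ?thesis by (simp add: norm_power)
  qed
  hence bound: "\<forall>k \<tau>. True \<longrightarrow> \<tau> \<in> {0..<T} \<longrightarrow>
      (case (k, \<tau>) of (k, \<tau>) \<Rightarrow> cmod (f (real k * T + \<tau>)) \<le>
        K * exp (\<bar>b\<bar> * T) * cmod (complex_of_real (exp (b * T) ^ k)))" by simp
  have "\<forall>\<^sub>F (k, \<tau>) in sequentially \<times>\<^sub>F principal {0..<T}.
      cmod (f (real k * T + \<tau>)) \<le> K * exp (\<bar>b\<bar> * T) * cmod (complex_of_real (exp (b * T) ^ k))"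
    unfolding eventually_prod_filter
    by (rule exI[of _ "\<lambda>_. True"], rule exI[of _ "\<lambda>\<tau>. \<tau> \<in> {0..<T}"])
      (use bound in \<open>simp add: eventually_principal\<close>)
  thus ?thesis
    by (intro bigoI[where c = "K * exp (\<bar>b\<bar> * T)"]) (simp add: case_prod_unfold)
qed

theorem corollary3p11:
  fixes n :: nat
    and \<alpha> :: "nat \<Rightarrow> real \<Rightarrow> complex"
    and \<alpha>s :: "nat \<Rightarrow> complex"
    and \<sigma> T :: real
    and x :: "real \<Rightarrow> real"
  assumes "n \<ge> 1"
    and "\<And>j. j \<le> n \<Longrightarrow> bounded (\<alpha> j ` {0..})"
    and "\<And>j. j \<le> n \<Longrightarrow> piecewise_continuous (\<alpha> j)"
    and "\<And>t. t \<ge> 0 \<Longrightarrow> \<alpha> 0 t = 1"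
    and "\<sigma> > 0"
    and "\<And>j. j \<le> n \<Longrightarrow>
           (\<lambda>t. \<alpha> j t - \<alpha>s j) \<in> o[at_top](\<lambda>t. complex_of_real (exp (- \<sigma> * t)))"
    and "ode_solution n \<alpha> (\<lambda>t. complex_of_real (x t))"
    and "\<not> (\<forall>\<^sub>F t in at_top. x t = 0)"
    and "T > 0"
  shows "\<exists>\<mu>>0. root_circle n \<alpha>s T \<mu> \<noteq> {} \<and>
           (\<exists>\<epsilon>. 0 < \<epsilon> \<and> \<epsilon> < \<mu> \<and>
             (\<exists>xs :: real \<Rightarrow> complex.
                ode_char_solution n \<alpha>s T (root_circle n \<alpha>s T \<mu>) xs \<and>
                (\<exists>t\<ge>0. xs t \<noteq> 0) \<and>
                (\<lambda>(k, \<tau>). complex_of_real (x (real k * T + \<tau>)) - xs (real k * T + \<tau>))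
                  \<in> O[sequentially \<times>\<^sub>F principal {0..<T}](\<lambda>(k, \<tau>). complex_of_real ((\<mu> - \<epsilon>) ^ k))))"
proof -

  \<comment> \<open>Characteristic roots of the limiting equation\<close>
  define A where "A = companion_matrix n \<alpha>s"
  have A: "A \<in> carrier_mat n n" by (simp add: A_def companion_matrix_def)
  obtain ls where ls: "char_poly A = (\<Prod>a\<leftarrow>ls. [:- a, 1:])" "length ls = n"
    using char_poly_factorized[OF A] by blast
  have error: "exp_bounded (- \<sigma>) (\<lambda>t. \<alpha> j t - \<alpha>s j)" if "j \<le> n" for j
    using assms(2,6) that by (intro exp_bounded_coefficient_error) auto
  \<comment> \<open>The companion matrix does not contain \<open>\<alpha>s 0\<close>. Its value
    follows because the constant error \<open>1 - \<alpha>s 0\<close> is bounded by a decaying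
    exponential; it identifies the characteristic polynomial with that of the limiting
    equation.\<close>
  have "\<alpha>s 0 = 1"
  proof (rule ccontr)
    assume "\<alpha>s 0 \<noteq> 1"
    from error[of 0] obtain M where M: "\<forall>t\<ge>0. cmod (1 - \<alpha>s 0) \<le> M * exp (- \<sigma> * t)"
      using assms(4) unfolding exp_bounded_def by auto
    have "((\<lambda>t. M * exp (- \<sigma> * t)) \<longlongrightarrow> M * 0) at_top"
      using assms(5) by (intro tendsto_mult tendsto_const filterlim_compose[OF exp_at_bot]
        filterlim_tendsto_neg_mult_at_bot[OF tendsto_const] filterlim_ident) auto
    hence "cmod (1 - \<alpha>s 0) \<le> M * 0"
      using M by (intro tendsto_lowerbound[where F = at_top and f = "\<lambda>t. M * exp (- \<sigma> * t)"])
        (auto intro!: eventually_at_top_linorderI[of 0])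
    thus False using \<open>\<alpha>s 0 \<noteq> 1\<close> by simp
  qed
  have coeff: "coeff (\<Prod>a\<leftarrow>ls. [:- a, 1:]) i = \<alpha>s (n - i)" if "i \<le> n" for i
    unfolding ls(1)[symmetric] A_def
    by (rule coeff_char_poly_companion_matrix) (use \<open>\<alpha>s 0 = 1\<close> that in auto)

  \<comment> \<open>The solution and its derivatives off the discontinuities\<close>
  define S where "S = {t. t \<ge> 0 \<and> (\<exists>j\<le>n. \<not> continuous (at t within {0..}) (\<alpha> j))}"
  have fin: "finite (S \<inter> {0..c})" for c
  proof -
    have "S \<inter> {0..c} \<subseteq> (\<Union>j\<le>n. {t \<in> {0..c}. \<not> continuous (at t within {0..}) (\<alpha> j)})"
      by (auto simp: S_def)
    thus ?thesis by (rule finite_subset) (use assms(3) in \<open>auto simp: piecewise_continuous_def\<close>)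
  qed
  obtain d0 where d0: "\<And>t. t \<ge> 0 \<Longrightarrow> d0 0 t = complex_of_real (x t)"
    and d0_deriv: "\<And>i t. Suc i < n \<Longrightarrow> t \<ge> 0 \<Longrightarrow> (d0 i has_vector_derivative d0 (Suc i) t) (at t within {0..})"
    and d0_cont: "continuous_on {0..} (d0 (n - 1))"
    and d0_eq: "\<And>t. t \<ge> 0 \<Longrightarrow> t \<notin> S \<Longrightarrow>
      (d0 (n - 1) has_vector_derivative d0 n t) (at t within {0..}) \<and> (\<Sum>i\<le>n. \<alpha> (n - i) t * d0 i t) = 0"
  proof -
    from assms(7)[unfolded ode_solution_def] show thesis
    proof (elim exE conjE, goal_cases)
      case (1 e)
      show thesis by (rule that[of e]) (use 1 in \<open>auto simp: S_def\<close>)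
    qed
  qed
  \<comment> \<open>The values of \<open>d n\<close> at the exceptional points are arbitrary; they are chosen so that the
     limiting equation holds there exactly.\<close>
  define d where "d i t = (if i = n \<and> t \<in> S then - (\<Sum>i<n. \<alpha>s (n - i) * d0 i t) else d0 i t)" for i t
  have d_eq [simp]: "d i = d0 i" if "i < n" for i using that by (auto simp: d_def fun_eq_iff)
  have sum_d: "(\<Sum>i\<le>n. c i * d i t) = (\<Sum>i<n. c i * d0 i t) + c n * d n t" for c t
    by (simp flip: lessThan_Suc_atMost)
  have cont: "continuous_on {0..} (d i)" if "i < n" for i
  proof (cases "Suc i < n")
    case True
    have "continuous_on {0..} (d0 i)"
      by (rule continuous_on_vector_derivative) (use d0_deriv[OF True] in auto)
    thus ?thesis using that by simp
  next
    case False
    hence "i = n - 1" using that by simp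
    thus ?thesis using d0_cont that by simp
  qed
  have deriv: "(d i has_vector_derivative d (Suc i) t) (at t within {0..})"
    if "i < n" "t \<ge> 0" "t \<notin> S" for i t
  proof (cases "Suc i < n")
    case True
    thus ?thesis using d0_deriv that by simp
  next
    case False
    hence "n = Suc i" using that by simp
    thus ?thesis using d0_eq[OF that(2,3)] that(3) by (simp add: d_def)
  qed
  have dn: "d n t = - (\<Sum>i<n. \<alpha> (n - i) t * d i t)" if "t \<ge> 0" "t \<notin> S" for t
  proof -
    have "(\<Sum>i<n. \<alpha> (n - i) t * d0 i t) + d n t = 0"
      using d0_eq[OF that] assms(4)[OF that(1)] that(2) by (simp add: d_def flip: lessThan_Suc_atMost)
    thus ?thesis by (simp add: add_eq_0_iff)
  qed

  \<comment> \<open>Exponential bounds for the energy from both sides\<close>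
  have "\<exists>B. \<forall>j\<le>n. \<forall>t\<ge>0. cmod (\<alpha> j t) \<le> B"
  proof -
    have "bounded (\<Union>j\<le>n. \<alpha> j ` {0..})" using assms(2) by (intro bounded_UN) auto
    thus ?thesis unfolding bounded_iff by fastforce
  qed
  then obtain B where B: "\<And>j t. j \<le> n \<Longrightarrow> t \<ge> 0 \<Longrightarrow> cmod (\<alpha> j t) \<le> B" by blast
  have "cmod (d n t) \<le> B * (\<Sum>i<n. cmod (d i t))" if "t \<ge> 0" "t \<notin> S" for t
    unfolding dn[OF that] norm_minus_cancel sum_distrib_left
    by (intro sum_norm_le) (auto simp: norm_mult that intro!: mult_right_mono B)
  from energy_bounds[OF fin cont deriv this] obtain K where
    K: "\<And>t. t \<ge> 0 \<Longrightarrow> (\<Sum>i<n. (cmod (d i 0))\<^sup>2) * exp (- K * t) \<le> (\<Sum>i<n. (cmod (d i t))\<^sup>2)"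
      "\<And>t. t \<ge> 0 \<Longrightarrow> (\<Sum>i<n. (cmod (d i t))\<^sup>2) \<le> (\<Sum>i<n. (cmod (d i 0))\<^sup>2) * exp (K * t)"
    by blast
  define E where "E = (\<Sum>i<n. (cmod (d i 0))\<^sup>2)"
  have "E \<ge> 0" by (simp add: E_def sum_nonneg)
  have le_energy: "(cmod (d i t))\<^sup>2 \<le> E * exp (K * t)" if "i < n" "t \<ge> 0" for i t
    using member_le_sum[of i "{..<n}" "\<lambda>i. (cmod (d i t))\<^sup>2"] K(2)[OF that(2)] that(1) by (simp add: E_def)
  \<comment> \<open>Zero initial energy would force x = 0 on [0, infinity), against the assumption
    on x.\<close>
  have "E > 0"
  proof (rule ccontr)
    assume "\<not> E > 0"
    hence "x t = 0" if "t \<ge> 0" for t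
      using le_energy[of 0 t] that assms(1) d0[OF that] \<open>E \<ge> 0\<close> by simp
    thus False using assms(8) by (auto simp: eventually_at_top_linorder)
  qed

  \<comment> \<open>Lowering the growth rate until it can be lowered no further\<close>
  define decays where "decays k \<longleftrightarrow> (\<forall>i<n. exp_bounded (K / 2 - real k * (\<sigma> / 2)) (d i))" for k
  \<comment> \<open>The rate starts at K / 2 because the energy is quadratic. It is lowered by
    \<sigma> / 2, half of what the coefficient errors gain, so that an interval remains in which to
    choose b.\<close>
  have "decays 0"
    unfolding decays_def exp_bounded_def
  proof (intro allI impI exI[of _ "sqrt E"])
    fix i and t :: real assume "i < n" "t \<ge> 0"
    have "(sqrt E * exp (K / 2 * t))\<^sup>2 = E * exp (K * t)"
      using \<open>E \<ge> 0\<close> by (simp add: power_mult_distrib flip: exp_double)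
    thus "cmod (d i t) \<le> sqrt E * exp ((K / 2 - real 0 * (\<sigma> / 2)) * t)"
      using le_energy[OF \<open>i < n\<close> \<open>t \<ge> 0\<close>] \<open>E \<ge> 0\<close> by - (rule power2_le_imp_le, auto)
  qed
  moreover have "\<exists>k. \<not> decays k"
  proof (rule ccontr)
    assume all: "\<nexists>k. \<not> decays k"
    \<comment> \<open>This k makes 2 c + K = 2 K - k \<sigma> negative, so the lower energy bound
      would squeeze E to 0.\<close>
    obtain k :: nat where k: "real k * (\<sigma> / 2) > K" using reals_Archimedean3[of "\<sigma> / 2"] assms(5) by auto
    define c where "c = K / 2 - real k * (\<sigma> / 2)"
    have "\<forall>i. \<exists>M. i < n \<longrightarrow> (\<forall>t\<ge>0. cmod (d i t) \<le> M * exp (c * t))"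
      using all unfolding decays_def exp_bounded_def c_def by blast
    then obtain M where M: "\<And>i t. i < n \<Longrightarrow> t \<ge> 0 \<Longrightarrow> cmod (d i t) \<le> M i * exp (c * t)" by metis
    define L where "L = (\<Sum>i<n. (M i)\<^sup>2)"
    have le: "E \<le> L * exp ((2 * c + K) * t)" if "t \<ge> 0" for t
    proof -
      have "E * exp (- K * t) \<le> (\<Sum>i<n. (cmod (d i t))\<^sup>2)" using K(1)[OF that] by (simp add: E_def)
      also have "\<dots> \<le> (\<Sum>i<n. (M i * exp (c * t))\<^sup>2)"
        using M that by (intro sum_mono power_mono) auto
      also have "\<dots> = L * exp (2 * c * t)"
        by (simp add: L_def power_mult_distrib sum_distrib_right mult.assoc flip: exp_double)
      finally show ?thesis by (simp add: exp_minus exp_add field_simps)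
    qed
    have "((\<lambda>t. L * exp ((2 * c + K) * t)) \<longlongrightarrow> L * 0) at_top"
      using k by (intro tendsto_mult tendsto_const filterlim_compose[OF exp_at_bot]
        filterlim_tendsto_neg_mult_at_bot[OF tendsto_const] filterlim_ident) (auto simp: c_def field_simps)
    hence "E \<le> L * 0"
      using le by (intro tendsto_lowerbound[where F = at_top and f = "\<lambda>t. L * exp ((2 * c + K) * t)"])
        (auto intro!: eventually_at_top_linorderI[of 0])
    thus False using \<open>E > 0\<close> by simp
  qed
  \<comment> \<open>Here the descent stops: rate k holds for all derivatives below order n, rate k +
    1 fails for one of them.\<close>
  ultimately obtain k where k: "decays k" "\<not> decays (Suc k)" by (metis nat_induct)

  \<comment> \<open>The dominant part at the last admissible rate\<close>
  define c where "c = K / 2 - real k * (\<sigma> / 2)"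
  have dc: "exp_bounded c (d i)" if "i < n" for i using k(1) that by (simp add: decays_def c_def)
  have "c - \<sigma> < c - \<sigma> / 2" using assms(5) by linarith
  \<comment> \<open>An open interval is infinite, so it contains a rate b that is not the real part
    of any characteristic root.\<close>
  have "\<not> {c - \<sigma><..<c - \<sigma> / 2} \<subseteq> Re ` set ls"
  proof
    assume "{c - \<sigma><..<c - \<sigma> / 2} \<subseteq> Re ` set ls"
    hence "finite {c - \<sigma><..<c - \<sigma> / 2}" by (rule finite_subset) simp
    with infinite_Ioo[OF \<open>c - \<sigma> < c - \<sigma> / 2\<close>] show False by contradiction
  qed
  then obtain b where "b \<in> {c - \<sigma><..<c - \<sigma> / 2}" and b_generic: "b \<notin> Re ` set ls" by blast
  hence b: "c - \<sigma> < b" "b < c - \<sigma> / 2" by auto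
  \<comment> \<open>Off S the limiting operator yields minus the sum of coefficient errors times
    derivatives, each O(exp((c - \<sigma>) t)); the order n drops out as both leading coefficients
    are 1. On S it yields 0 by the choice of \<open>d n\<close>.\<close>
  have "exp_bounded b (\<lambda>t. \<Sum>i\<le>length ls. coeff (\<Prod>a\<leftarrow>ls. [:- a, 1:]) i * d i t)"
  proof -
    have "exp_bounded (- \<sigma> + c) (\<lambda>t. (\<alpha> (n - i) t - \<alpha>s (n - i)) * d i t)" if "i < n" for i
      using that by (intro exp_bounded_mult error dc) auto
    hence "exp_bounded (c - \<sigma>) (\<lambda>t. \<Sum>i<n. (\<alpha> (n - i) t - \<alpha>s (n - i)) * d i t)"
      by (intro exp_bounded_sum) auto
    hence "exp_bounded (c - \<sigma>) (\<lambda>t. \<Sum>i\<le>n. \<alpha>s (n - i) * d i t)"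
    proof (rule exp_bounded_dominated)
      fix t :: real assume t: "t \<ge> 0"
      show "cmod (\<Sum>i\<le>n. \<alpha>s (n - i) * d i t) \<le> cmod (\<Sum>i<n. (\<alpha> (n - i) t - \<alpha>s (n - i)) * d i t)"
      proof (cases "t \<in> S")
        case True
        hence "(\<Sum>i\<le>n. \<alpha>s (n - i) * d i t) = 0"
          unfolding sum_d using \<open>\<alpha>s 0 = 1\<close> by (simp add: d_def)
        thus ?thesis by simp
      next
        case False
        hence "(\<Sum>i\<le>n. \<alpha>s (n - i) * d i t) = - (\<Sum>i<n. (\<alpha> (n - i) t - \<alpha>s (n - i)) * d i t)"
          unfolding sum_d using \<open>\<alpha>s 0 = 1\<close> dn[OF t False] by (simp add: algebra_simps sum_subtractf)
        thus ?thesis by simp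
      qed
    qed
    moreover have "(\<Sum>i\<le>length ls. coeff (\<Prod>a\<leftarrow>ls. [:- a, 1:]) i * d i t) = (\<Sum>i\<le>n. \<alpha>s (n - i) * d i t)" for t
      unfolding ls(2) by (rule sum.cong) (auto simp: coeff)
    ultimately show ?thesis using b(1) by (auto elim: exp_bounded_mono)
  qed
  note small = this
  \<comment> \<open>The rate of step k + 1 is c - \<sigma> / 2, which exceeds b; so the bound with b
    fails wherever that one does.\<close>
  have "\<exists>i\<le>length ls. \<not> exp_bounded b (d i)"
  proof -
    obtain i where "i < n" "\<not> exp_bounded (c - \<sigma> / 2) (d i)"
      using k(2) by (auto simp: decays_def c_def algebra_simps add_divide_distrib)
    moreover have "b \<le> c - \<sigma> / 2" using b(2) by simp
    ultimately show ?thesis unfolding ls(2) using exp_bounded_mono by (meson less_imp_le)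
  qed
  note large = this
  obtain \<rho> b' p where "b' < \<rho>" and p: "\<And>\<nu>. (pderiv ^^ count_list ls \<nu>) (p \<nu>) = 0"
    and p0: "\<And>\<nu> t. (\<Sum>i\<le>length ls. coeff (\<Prod>a\<leftarrow>ls. [:- a, 1:]) i * expoly \<nu> ((expoly_deriv \<nu> ^^ i) (p \<nu>)) t) = 0"
    and nz: "\<exists>t\<ge>0. (\<Sum>\<nu> | \<nu> \<in> set ls \<and> Re \<nu> = \<rho>. expoly \<nu> (p \<nu>) t) \<noteq> 0"
    and rest: "exp_bounded b' (\<lambda>t. d 0 t - (\<Sum>\<nu> | \<nu> \<in> set ls \<and> Re \<nu> = \<rho>. expoly \<nu> (p \<nu>) t))"
    by (rule principal_part[OF fin _ _ small _ large]) (use ls(2) cont deriv b_generic in auto)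

  \<comment> \<open>Sampling the dominant part\<close>
  define xs where "xs t = (\<Sum>\<nu> | \<nu> \<in> set ls \<and> Re \<nu> = \<rho>. expoly \<nu> (p \<nu>) t)" for t
  define P where "P = sampled_char_poly n \<alpha>s T"
  have P: "P = (\<Prod>a\<leftarrow>ls. [:- exp (complex_of_real T * a), 1:])"
    unfolding P_def sampled_char_poly_def A_def[symmetric] by (rule char_poly_mat_exp_smult[OF A ls(1)])
  define \<mu> where "\<mu> = exp (\<rho> * T)"
  \<comment> \<open>Chosen so that \<mu> - \<epsilon> = exp(b' T): positive, and below \<mu> because
    b' < \<rho>.\<close>
  define \<epsilon> where "\<epsilon> = \<mu> - exp (b' * T)"
  have circle: "root_circle n \<alpha>s T \<mu> = {z. poly P z = 0 \<and> cmod z = exp (\<rho> * T)}"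
    by (simp add: root_circle_def P_def \<mu>_def)
  have "\<exists>\<nu>. \<nu> \<in> set ls \<and> Re \<nu> = \<rho>"
  proof (rule ccontr)
    assume "\<nexists>\<nu>. \<nu> \<in> set ls \<and> Re \<nu> = \<rho>"
    hence "{\<nu>. \<nu> \<in> set ls \<and> Re \<nu> = \<rho>} = {}" by blast
    thus False using nz by (simp only: sum.empty) simp
  qed
  then obtain \<nu> where \<nu>: "\<nu> \<in> set ls" "Re \<nu> = \<rho>" by blast
  have "poly P (exp (complex_of_real T * \<nu>)) = 0"
    unfolding P poly_prod_list prod_list_zero_iff using \<nu>(1) by force
  hence "exp (complex_of_real T * \<nu>) \<in> root_circle n \<alpha>s T \<mu>"
    using \<nu>(2) by (simp add: circle mult.commute)
  hence "root_circle n \<alpha>s T \<mu> \<noteq> {}" by blast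
  moreover have "0 < \<epsilon>" "\<epsilon> < \<mu>" using \<open>b' < \<rho>\<close> assms(9) by (simp_all add: \<epsilon>_def \<mu>_def)
  moreover have "ode_char_solution n \<alpha>s T (root_circle n \<alpha>s T \<mu>) xs"
    unfolding ode_char_solution_def P_def[symmetric] circle xs_def [abs_def]
  proof
    show "ode_solution n (\<lambda>j _. \<alpha>s j) (\<lambda>t. \<Sum>\<nu> | \<nu> \<in> set ls \<and> Re \<nu> = \<rho>. expoly \<nu> (p \<nu>) t)"
    proof (rule ode_solution_expoly_sum[OF assms(1)])
      show "(\<Sum>i\<le>n. \<alpha>s (n - i) * expoly \<nu> ((expoly_deriv \<nu> ^^ i) (p \<nu>)) t) = 0" for \<nu> t
        using p0[of \<nu> t] coeff unfolding ls(2) by simp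
    qed
  qed (rule char_solution_set_sampled_expoly[OF P p])
  moreover have "\<exists>t\<ge>0. xs t \<noteq> 0" using nz by (simp add: xs_def)
  moreover have "(\<lambda>(k, \<tau>). complex_of_real (x (real k * T + \<tau>)) - xs (real k * T + \<tau>))
      \<in> O[sequentially \<times>\<^sub>F principal {0..<T}](\<lambda>(k, \<tau>). complex_of_real ((\<mu> - \<epsilon>) ^ k))"
  proof -
    have "exp_bounded b' (\<lambda>t. complex_of_real (x t) - xs t)"
      using rest assms(1) d0 by (auto simp: xs_def elim!: exp_bounded_cong)
    from exp_bounded_imp_bigo_samples[OF this assms(9)] show ?thesis by (simp add: \<epsilon>_def)
  qed
  moreover have "\<mu> > 0" by (simp add: \<mu>_def)
  ultimately show ?thesis by blast
qed

end
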